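(* Assume (h1)–(h5) (stated in the context). Given $(t,x)\in[0,T)\times\mathbb{R}^n$, the value function $U(t,x)$ is a solution of the equation $$ \sup_{\zeta\in C^+\setminus\{0\}}\bigl[U_{t,\zeta}(t,x)-_\zeta\mathcal{L}_t^*(t,-\nabla u_\zeta(t,x),\zeta)-w(t,x,\zeta)\bigr]=C, $$ where $\nabla u_\zeta(t,x)=d_t(T)\nabla g_\zeta(Y_{t,x,\zeta}(T))$ and $$ w(t,x,\zeta)=\int_t^T\frac{\partial d_t(s)}{\partial t}L\bigl(\dot Y_{t,x,\zeta}(s)\bigr)ds+\frac{\partial d_t(T)}{\partial t}g(Y_{t,x,\zeta}(T))\in\mathbb{R}^d . $$
   Context: Let $C\subset\mathbb{R}^d$ be a closed convex cone with nonempty interior and $C^+=\{\zeta\in\mathbb{R}^d : \zeta\cdot z\ge 0\ \forall z\in C\}$. For $\zeta\in C^+\setminus\{0\}$, $H^+(\zeta)=\{z\in\mathbb{R}^d:\zeta\cdot z\ge0\}$. $A+B$ is the Minkowski sum (with $A+\emptyset=\emptyset$), $A\oplus B=\mathrm{cl}(A+B)$; a vector added to (or subtracted from) a set is a translation. $\mathcal{F}(\mathbb{R}^d,C)=\{A\subseteq\mathbb{R}^d : A=A\oplus C\}$, ordered by $\supseteq$, is a complete lattice with $\inf\mathcal{A}=\mathrm{cl}\bigcup_{A\in\mathcal{A}}A$, $\sup\mathcal{A}=\bigcap_{A\in\mathcal{A}}A$ (the sup in the claim is this intersection). The $\zeta$-difference is $A-_\zeta B=\{z\in\mathbb{R}^d: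 z+B\subseteq A\oplus H^+(\zeta)\}$. Limits of sets: $\lim_{m\to\infty}A_m=\{z : \exists z_m\in A_m\ (m\in\mathbb{N}),\ z_m\to z\}$, and $\lim_{s\to s_*}A_s$ is the set equal to $\lim_mA_{s_m}$ for every sequence $s_m\to s_*$. For $\eta\in\mathbb{R}^n$, $\zeta\in C^+$: $S_{(\eta,\zeta)}(x)=\{z\in\mathbb{R}^d:\zeta\cdot z\ge\eta\cdot x\}$. The Fenchel conjugate of $f:\mathbb{R}^n\to\mathcal{F}(\mathbb{R}^d,C)$ is $f^*(\eta,\zeta)=\sup_{x\in\mathbb{R}^n}\bigl(S_{(\eta,\zeta)}(x)-_\zeta f(x)\bigr)$ for $\eta\in\mathbb{R}^n$, $\zeta\in C^+\setminus\{0\}$; $\mathcal{L}_t^*(s,\eta,\zeta)$ denotes the conjugate of $\mathcal{L}_t(s,\cdot)$ at $(\eta,\zeta)$. Let $T>0$, $L,g:\mathbb{R}^n\to\mathbb{R}^d$, and let $d_t(s)>0$ ($t\in[0,T]$, $s\in[t,T]$) be a discount factor. For $\zeta\in C^+\setminus\{0\}$ put $L_\zeta(w)=L(w)\cdot\zeta$, $g_\zeta(w)=g(w)\cdot\zeta$. Let $B^+$ be a base of $C^+$ (each $\zeta\in C^+\setminus\{0\}$ is uniquely $\lambda\xi$ with $\lambda>0$, $\xi\in B^+$). Hypotheses: (h1) for all $\zeta\in B^+$, $L_\zeta$ is $C^2$, strictly convex and coercive: $\lim_{|w|\to\infty}L_\zeta(w)/|w|=+\infty$ (so $\nabla L_\zeta$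 is a homeomorphism of $\mathbb{R}^n$ for every $\zeta\in C^+\setminus\{0\}$); (h2) for all $\zeta\in B^+$, $g_\zeta$ is globally Lipschitz in $\mathbb{R}^n$; (h3) for any $t\in[0,T]$, $d_t:[t,T]\to(a,1]$, with $a>0$, is continuous, and $d_t(t)=1$; (h4) the discount factor is of class $C^1$ in $t$; (h5) for all $\zeta\in B^+$, $g_\zeta$ is $C^2$ and convex. $\mathcal{L}_t(s,w)=d_t(s)L(w)+C$ for $s\in[t,T]$, $w\in\mathbb{R}^n$. For $y\in W^{1,1}([t,T],\mathbb{R}^n)$: $I_t(y)=\int_t^Td_t(s)L(\dot y(s))\,ds+d_t(T)g(y(T))$, $I_{t,\zeta}(y)=I_t(y)\cdot\zeta$, $J_t(y)=\int_t^T\mathcal{L}_t(s,\dot y(s))\,ds+d_t(T)g(y(T))$ (Aumann integral; $\int_t^tF\,ds=C$). $A(t,x)=\{y\in W^{1,1}([t,T],\mathbb{R}^n): y(t)=x\}$, and $U(t,x)=\inf_{y\in A(t,x)}J_t(y)$ in $\mathcal{F}(\mathbb{R}^d,C)$. $Y_{t,x,p,\zeta}(s)=x+\int_t^s(\nabla L_\zeta)^{-1}\bigl(p/d_t(r)\bigr)dr$, and $Y_{t,x,\zeta}=Y_{t,x,p(t,x,\zeta),\zeta}$, where $p(t,x,\zeta)\in\mathbb{R}^n$ is a point with $I_{t,\zeta}(Y_{t,x,p(t,x,\zeta),\zeta})=\inf_{p\in\mathbb{R}^n}I_{t,\zeta}(Y_{t,x,p,\zeta})$ (such a point exists). The derivative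 of $U$ in $t$ is $$U_{t,\zeta}(t,x)=\lim_{s\to0^+}\frac1s\bigl[U(t+s,x)-_\zeta U(t,x)\bigr].$$ *)

theory Defs
  imports "HOL-Analysis.Analysis"
begin

subsection \<open>Calculus on Euclidean spaces\<close>

definition grad :: "('a::euclidean_space \<Rightarrow> real) \<Rightarrow> 'a \<Rightarrow> 'a" where
  "grad f x = (THE D. GDERIV f x :> D)"

definition C2_function :: "('a::euclidean_space \<Rightarrow> real) \<Rightarrow> bool" where
  "C2_function f \<longleftrightarrow>
     (\<exists>(f' :: 'a \<Rightarrow> 'a \<Rightarrow>\<^sub>L real) (f'' :: 'a \<Rightarrow> 'a \<Rightarrow>\<^sub>L ('a \<Rightarrow>\<^sub>L real)).
        (\<forall>x. (f has_derivative blinfun_apply (f' x)) (at x)) \<and>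
        (\<forall>x. (f' has_derivative blinfun_apply (f'' x)) (at x)) \<and>
        continuous_on UNIV f'')"

definition strictly_convex :: "('a::real_vector \<Rightarrow> real) \<Rightarrow> bool" where
  "strictly_convex f \<longleftrightarrow>
     (\<forall>x y u. x \<noteq> y \<longrightarrow> 0 < u \<longrightarrow> u < 1 \<longrightarrow>
        f ((1 - u) *\<^sub>R x + u *\<^sub>R y) < (1 - u) * f x + u * f y)"

definition coercive :: "('a::real_normed_vector \<Rightarrow> real) \<Rightarrow> bool" where
  "coercive f \<longleftrightarrow> filterlim (\<lambda>w. f w / norm w) at_top at_infinity"

text \<open>
  \<open>W\<^sup>1\<^sup>,\<^sup>1([t,T])\<close> is described by its absolutely continuous representatives
  (pointwise values such as \<open>y(t) = x\<close> refer to these): \<open>y\<close> is the primitive of an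
  integrable function \<open>v\<close>, its derivative. As \<open>v\<close> is determined up to null sets only,
  \<open>wderiv\<close> picks one version; it is used under integrals only, where the choice is immaterial.
  Functions on \<open>[t,T]\<close> are functions on the whole line whose values outside \<open>[t,T]\<close> are ignored.
\<close>

definition has_wderiv :: "real \<Rightarrow> real \<Rightarrow> (real \<Rightarrow> 'a::euclidean_space) \<Rightarrow> (real \<Rightarrow> 'a) \<Rightarrow> bool" where
  "has_wderiv t T y v \<longleftrightarrow>
     set_integrable lebesgue {t..T} v \<and>
     (\<forall>s\<in>{t..T}. y s = y t + (LINT r:{t..s}|lebesgue. v r))"

definition W11 :: "real \<Rightarrow> real \<Rightarrow> (real \<Rightarrow> 'a::euclidean_space) set" where
  "W11 t T = {y. \<exists>v. has_wderiv t T y v}"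

definition wderiv :: "real \<Rightarrow> real \<Rightarrow> (real \<Rightarrow> 'a::euclidean_space) \<Rightarrow> real \<Rightarrow> 'a" where
  "wderiv t T y = (SOME v. has_wderiv t T y v)"


subsection \<open>Cones and the lattice \<open>\<F>(\<real>\<^sup>d, C)\<close>\<close>

definition dual_cone :: "'a::euclidean_space set \<Rightarrow> 'a set" where
  "dual_cone C = {\<zeta>. \<forall>z\<in>C. 0 \<le> \<zeta> \<bullet> z}"

definition is_base :: "'a::real_vector set \<Rightarrow> 'a set \<Rightarrow> bool" where
  "is_base B K \<longleftrightarrow> B \<subseteq> K - {0} \<and>
     (\<forall>\<zeta>\<in>K - {0}. \<exists>!(l, \<xi>). 0 < (l::real) \<and> \<xi> \<in> B \<and> \<zeta> = l *\<^sub>R \<xi>)"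

definition Hplus :: "'a::euclidean_space \<Rightarrow> 'a set" where
  "Hplus \<zeta> = {z. 0 \<le> \<zeta> \<bullet> z}"

text \<open>
  Below, \<open>+\<close> on sets is the Minkowski sum. The elements of the lattice are the sets \<open>A\<close> with
  \<open>A = A \<oplus> C\<close>, ordered by \<open>\<supseteq>\<close>; hence its infimum is the closure of the union, and its supremum
  is the intersection \<open>\<Inter>\<close> (which is the whole space for the empty family).
\<close>

definition oplus :: "'a::euclidean_space set \<Rightarrow> 'a set \<Rightarrow> 'a set" where
  "oplus A B = closure (A + B)"

definition set_inf :: "'a::euclidean_space set set \<Rightarrow> 'a set" where
  "set_inf \<A> = closure (\<Union>\<A>)"

definition zdiff :: "'a::euclidean_space \<Rightarrow> 'a set \<Rightarrow> 'a set \<Rightarrow> 'a set" where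
  "zdiff \<zeta> A B = {z. (+) z ` B \<subseteq> oplus A (Hplus \<zeta>)}"

definition Ssc :: "'n::euclidean_space \<Rightarrow> 'd::euclidean_space \<Rightarrow> 'n \<Rightarrow> 'd set" where
  "Ssc \<eta> \<zeta> x = {z. \<zeta> \<bullet> z \<ge> \<eta> \<bullet> x}"

definition fenchel_conj ::
  "('n::euclidean_space \<Rightarrow> 'd::euclidean_space set) \<Rightarrow> 'n \<Rightarrow> 'd \<Rightarrow> 'd set" where
  "fenchel_conj f \<eta> \<zeta> = (\<Inter>x. zdiff \<zeta> (Ssc \<eta> \<zeta> x) (f x))"


subsection \<open>Limits of sets\<close>

definition set_lim_seq :: "(nat \<Rightarrow> 'a::topological_space set) \<Rightarrow> 'a set" where
  "set_lim_seq A = {z. \<exists>\<phi>. (\<forall>m. \<phi> m \<in> A m) \<and> \<phi> \<longlonglongrightarrow> z}"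

text \<open>\<open>S\<close> is the domain of the family \<open>A\<close>; as usual for limits, \<open>a\<close> itself is not approached by \<open>a\<close>.\<close>

definition has_set_lim :: "(real \<Rightarrow> 'a::topological_space set) \<Rightarrow> real set \<Rightarrow> real \<Rightarrow> 'a set \<Rightarrow> bool" where
  "has_set_lim A S a D \<longleftrightarrow>
     (\<forall>\<sigma>::nat \<Rightarrow> real. (\<forall>m. \<sigma> m \<in> S - {a}) \<longrightarrow> \<sigma> \<longlonglongrightarrow> a \<longrightarrow> set_lim_seq (\<lambda>m. A (\<sigma> m)) = D)"

definition set_lim :: "(real \<Rightarrow> 'a::topological_space set) \<Rightarrow> real set \<Rightarrow> real \<Rightarrow> 'a set" where
  "set_lim A S a = (THE D. has_set_lim A S a D)"


subsection \<open>The variational problem\<close>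

text \<open>The discount factor \<open>d\<^sub>t(s)\<close> is \<open>d t s\<close>.\<close>

definition aumann ::
  "'d::euclidean_space set \<Rightarrow> real \<Rightarrow> real \<Rightarrow> (real \<Rightarrow> 'd set) \<Rightarrow> 'd set" where
  "aumann C t T F =
     (if t = T then C
      else {(LINT s:{t..T}|lebesgue. f s) | f.
              set_integrable lebesgue {t..T} f \<and>
              (AE s in lebesgue. s \<in> {t..T} \<longrightarrow> f s \<in> F s)})"

definition Lset ::
  "'d::euclidean_space set \<Rightarrow> ('n::euclidean_space \<Rightarrow> 'd) \<Rightarrow> (real \<Rightarrow> real \<Rightarrow> real)
     \<Rightarrow> real \<Rightarrow> real \<Rightarrow> 'n \<Rightarrow> 'd set" where
  "Lset C L d t s w = (+) (d t s *\<^sub>R L w) ` C"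

text \<open>
  The integrals in \<open>I_fun\<close> and \<open>w_fun\<close> are vector-valued Lebesgue integrals, which are \<open>0\<close> for a
  non-integrable integrand. If \<open>C\<close> is pointed, regularity of all the functions \<open>L \<bullet> \<zeta>\<close> with
  \<open>\<zeta> \<in> C\<^sup>+\<close> makes \<open>L\<close> continuous (\<open>C\<^sup>+\<close> spans the space), and the integrals along the curves
  \<open>Y_path\<close> below exist. If \<open>C\<close> contains a line, nothing is known about the components of \<open>L\<close> in
  the lineality space \<open>C \<inter> -C\<close>, and the existence of these integrals is a separate condition.
\<close>

definition I_fun ::
  "('n::euclidean_space \<Rightarrow> 'd::euclidean_space) \<Rightarrow> ('n \<Rightarrow> 'd) \<Rightarrow> (real \<Rightarrow> real \<Rightarrow> real) \<Rightarrow> real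
     \<Rightarrow> real \<Rightarrow> (real \<Rightarrow> 'n) \<Rightarrow> 'd" where
  "I_fun L g d T t y =
     (LINT s:{t..T}|lebesgue. d t s *\<^sub>R L (wderiv t T y s)) + d t T *\<^sub>R g (y T)"

definition J_fun ::
  "'d::euclidean_space set \<Rightarrow> ('n::euclidean_space \<Rightarrow> 'd) \<Rightarrow> ('n \<Rightarrow> 'd) \<Rightarrow> (real \<Rightarrow> real \<Rightarrow> real)
     \<Rightarrow> real \<Rightarrow> real \<Rightarrow> (real \<Rightarrow> 'n) \<Rightarrow> 'd set" where
  "J_fun C L g d T t y =
     (+) (d t T *\<^sub>R g (y T)) ` aumann C t T (\<lambda>s. Lset C L d t s (wderiv t T y s))"

definition admissible :: "real \<Rightarrow> real \<Rightarrow> 'n::euclidean_space \<Rightarrow> (real \<Rightarrow> 'n) set" where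
  "admissible T t x = {y \<in> W11 t T. y t = x}"

definition U_val ::
  "'d::euclidean_space set \<Rightarrow> ('n::euclidean_space \<Rightarrow> 'd) \<Rightarrow> ('n \<Rightarrow> 'd) \<Rightarrow> (real \<Rightarrow> real \<Rightarrow> real)
     \<Rightarrow> real \<Rightarrow> real \<Rightarrow> 'n \<Rightarrow> 'd set" where
  "U_val C L g d T t x = set_inf (J_fun C L g d T t ` admissible T t x)"

text \<open>
  The time derivative \<open>U\<^bsub>t,\<zeta>\<^esub>(t,x)\<close> of a set-valued \<open>U\<close> is the limit of \<open>U_quot\<close> for
  \<open>s \<rightarrow> 0\<^sup>+\<close>, where \<open>s\<close> ranges over \<open>(0, T - t]\<close> because \<open>U\<close> is defined for times in \<open>[0,T]\<close>.
\<close>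

definition U_quot ::
  "(real \<Rightarrow> 'n \<Rightarrow> 'd::euclidean_space set) \<Rightarrow> 'd \<Rightarrow> real \<Rightarrow> 'n \<Rightarrow> real \<Rightarrow> 'd set" where
  "U_quot U \<zeta> t x s = (*\<^sub>R) (1 / s) ` zdiff \<zeta> (U (t + s) x) (U t x)"

definition has_U_t ::
  "(real \<Rightarrow> 'n \<Rightarrow> 'd::euclidean_space set) \<Rightarrow> real \<Rightarrow> 'd \<Rightarrow> real \<Rightarrow> 'n \<Rightarrow> 'd set \<Rightarrow> bool" where
  "has_U_t U T \<zeta> t x D \<longleftrightarrow> has_set_lim (U_quot U \<zeta> t x) {0<..T - t} 0 D"

definition U_t ::
  "(real \<Rightarrow> 'n \<Rightarrow> 'd::euclidean_space set) \<Rightarrow> real \<Rightarrow> 'd \<Rightarrow> real \<Rightarrow> 'n \<Rightarrow> 'd set" where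
  "U_t U T \<zeta> t x = set_lim (U_quot U \<zeta> t x) {0<..T - t} 0"

definition Y_path ::
  "('n::euclidean_space \<Rightarrow> 'd::euclidean_space) \<Rightarrow> (real \<Rightarrow> real \<Rightarrow> real)
     \<Rightarrow> real \<Rightarrow> 'n \<Rightarrow> 'n \<Rightarrow> 'd \<Rightarrow> real \<Rightarrow> 'n" where
  "Y_path L d t x p \<zeta> s =
     x + (LINT r:{t..s}|lebesgue. inv (grad (\<lambda>w. L w \<bullet> \<zeta>)) (p /\<^sub>R d t r))"

definition grad_u ::
  "('n::euclidean_space \<Rightarrow> 'd::euclidean_space) \<Rightarrow> (real \<Rightarrow> real \<Rightarrow> real) \<Rightarrow> real
     \<Rightarrow> real \<Rightarrow> 'd \<Rightarrow> (real \<Rightarrow> 'n) \<Rightarrow> 'n" where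
  "grad_u g d T t \<zeta> Y = d t T *\<^sub>R grad (\<lambda>x. g x \<bullet> \<zeta>) (Y T)"

text \<open>\<open>d'\<close> is the partial derivative of the discount factor in its lower index \<open>t\<close>.\<close>

definition w_fun ::
  "('n::euclidean_space \<Rightarrow> 'd::euclidean_space) \<Rightarrow> ('n \<Rightarrow> 'd) \<Rightarrow> (real \<Rightarrow> real \<Rightarrow> real) \<Rightarrow> real
     \<Rightarrow> real \<Rightarrow> (real \<Rightarrow> 'n) \<Rightarrow> 'd" where
  "w_fun L g d' T t Y =
     (LINT s:{t..T}|lebesgue. d' t s *\<^sub>R L (wderiv t T Y s)) + d' t T *\<^sub>R g (Y T)"

end

theory Submission
  imports Defs
begin

text \<open>
  Every set in the equation is tested against one functional \<open>\<zeta> \<in> C\<^sup>+\<close>: \<open>A \<oplus> H\<^sup>+(\<zeta>)\<close> is a half-space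
  that remembers only the number \<open>inf {\<zeta> \<bullet> z | z \<in> A}\<close>, and \<open>\<zeta>\<close>-differences, limits of
  quotients and conjugates of such sets are half-spaces whose offsets are the corresponding
  differences, limits and conjugates of numbers. So for fixed \<open>\<zeta>\<close> the bracket in the equation
  becomes \<open>{z. u\<^sub>t - L\<^sub>\<zeta>\<^sup>*(-\<nabla>u) - \<zeta> \<bullet> w \<le> \<zeta> \<bullet> z}\<close>, where \<open>u(\<tau>)\<close> is the value of the scalar
  problem of minimizing \<open>\<integral> d\<^sub>\<tau> L\<^sub>\<zeta>(y') + d\<^sub>\<tau>(T) g\<^sub>\<zeta>(y(T))\<close>. The scalar Hamilton-Jacobi identity
  \<open>u\<^sub>t = L\<^sub>\<zeta>\<^sup>*(-\<nabla>u) + \<zeta> \<bullet> w\<close> makes this half-space equal to \<open>H\<^sup>+(\<zeta>)\<close>, and a closed convex cone is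
  the intersection of the half-spaces \<open>H\<^sup>+(\<zeta>)\<close> with \<open>\<zeta> \<in> C\<^sup>+ - {0}\<close>.

  The scalar identity is an envelope argument. Since \<open>g\<^sub>\<zeta>\<close> is Lipschitz, Brouwer's theorem gives
  a costate \<open>q = -d\<^sub>t(T) \<nabla>g\<^sub>\<zeta>(Y(T))\<close> for the path \<open>Y\<close> with velocity
  \<open>v(r) = (\<nabla>L\<^sub>\<zeta>)\<^sup>-\<^sup>1(q / d\<^sub>t(r))\<close> (\<open>ex_costate\<close>). The same control \<open>v\<close>, restricted to \<open>[t + s, T]\<close>,
  is an almost optimal competitor at the initial time \<open>t + s\<close>: tangent inequalities
  for the convex functions \<open>L\<^sub>\<zeta>\<close> and \<open>g\<^sub>\<zeta>\<close> bound the cost of every other curve from below by the cost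
  of \<open>v\<close> minus the integral of an explicit \<open>gap\<close> (\<open>cost_lower_bound\<close>). The gap is a product of the
  defect in the first-order condition, which is \<open>O(s)\<close>, and of a change of velocity, which is
  \<open>o(1)\<close>; so it is \<open>o(s)\<close> (\<open>gap_integral_small\<close>) and vanishes at \<open>s = 0\<close>. Therefore \<open>u\<close> has the
  same right derivative at \<open>t\<close> as the cost of the fixed control \<open>v\<close>, and that one is
  computed directly (\<open>cost_derivative\<close>). Strict
  convexity shows that the minimizing \<open>p(t,x,\<zeta>)\<close> of the statement is this \<open>q\<close>
  (\<open>minimizing_costate_unique\<close>).
\<close>

section \<open>Gradients of convex functions\<close>

lemma GDERIV_unique:
  fixes f :: "'a::euclidean_space \<Rightarrow> real"
  assumes "GDERIV f x :> D" "GDERIV f x :> E"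
  shows "D = E"
proof -
  have "(\<lambda>h. h \<bullet> D) = (\<lambda>h. h \<bullet> E)"
    using assms unfolding gderiv_def by (rule has_derivative_unique)
  then show ?thesis
    by (metis inner_commute vector_eq_rdot)
qed

lemma grad_eqI:
  fixes f :: "'a::euclidean_space \<Rightarrow> real"
  assumes "GDERIV f x :> D"
  shows "grad f x = D"
  unfolding grad_def using assms by (rule the_equality) (rule GDERIV_unique[OF _ assms])

text \<open>
  The gradient is assembled from the coordinates of the derivative functional, and inherits its
  differentiability from them.
\<close>

lemma C2_function_grad:
  fixes f :: "'a::euclidean_space \<Rightarrow> real"
  assumes "C2_function f"
  shows "GDERIV f x :> grad f x" and "grad f differentiable (at x)"
proof -
  obtain f' :: "'a \<Rightarrow> 'a \<Rightarrow>\<^sub>L real" and f'' where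
    f': "\<And>x. (f has_derivative blinfun_apply (f' x)) (at x)" and
    f'': "\<And>x. (f' has_derivative blinfun_apply (f'' x)) (at x)"
    using assms unfolding C2_function_def by blast
  define G where "G x = (\<Sum>i\<in>Basis. f' x i *\<^sub>R i)" for x
  have G: "GDERIV f x :> G x" for x
  proof -
    have "blinfun_apply (f' x) = (\<lambda>h. h \<bullet> G x)"
    proof
      fix h
      have "f' x h = f' x (\<Sum>i\<in>Basis. (h \<bullet> i) *\<^sub>R i)"
        by (simp add: euclidean_representation)
      also have "\<dots> = (\<Sum>i\<in>Basis. (h \<bullet> i) * f' x i)"
        by (simp add: blinfun.sum_right blinfun.scaleR_right)
      also have "\<dots> = h \<bullet> G x"
        by (simp add: G_def inner_sum_right mult.commute)
      finally show "f' x h = h \<bullet> G x" .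
    qed
    then show ?thesis
      using f'[of x] by (simp add: gderiv_def)
  qed
  then have eq: "grad f = G"
    by (intro ext grad_eqI)
  show "GDERIV f x :> grad f x"
    unfolding eq by (rule G)
  have "((\<lambda>x. f' x i) has_derivative (\<lambda>h. f'' x h i)) (at x)" for i
    by (rule bounded_linear.has_derivative[OF blinfun.bounded_linear_left f''])
  then have "(\<lambda>x. f' x i *\<^sub>R i) differentiable (at x)" for i :: 'a
    unfolding differentiable_def using has_derivative_scaleR_left by blast
  then show "grad f differentiable (at x)"
    unfolding eq G_def by (intro differentiable_sum) auto
qed

lemma C2_function_scaleR:
  fixes f :: "'a::euclidean_space \<Rightarrow> real"
  assumes "C2_function f"
  shows "C2_function (\<lambda>x. c * f x)"
proof -
  obtain f' :: "'a \<Rightarrow> 'a \<Rightarrow>\<^sub>L real" and f'' where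
    f': "\<And>x. (f has_derivative blinfun_apply (f' x)) (at x)" and
    f'': "\<And>x. (f' has_derivative blinfun_apply (f'' x)) (at x)" and
    cont: "continuous_on UNIV f''"
    using assms unfolding C2_function_def by blast
  have e: "blinfun_apply (c *\<^sub>R B) = (\<lambda>h. c *\<^sub>R blinfun_apply B h)" for B :: "'a \<Rightarrow>\<^sub>L 'b::real_normed_vector"
    by (simp add: fun_eq_iff blinfun.scaleR_left)
  show ?thesis
    unfolding C2_function_def
  proof (intro exI conjI allI)
    show "((\<lambda>x. c * f x) has_derivative blinfun_apply (c *\<^sub>R f' x)) (at x)" for x
      unfolding e using has_derivative_scaleR_right[OF f'] by simp
    show "((\<lambda>x. c *\<^sub>R f' x) has_derivative blinfun_apply (c *\<^sub>R f'' x)) (at x)" for x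
      unfolding e by (rule has_derivative_scaleR_right[OF f''])
    show "continuous_on UNIV (\<lambda>x. c *\<^sub>R f'' x)"
      by (intro continuous_intros cont)
  qed
qed

lemma strictly_convex_scaleR:
  fixes f :: "'a::real_vector \<Rightarrow> real"
  assumes "strictly_convex f" "0 < c"
  shows "strictly_convex (\<lambda>x. c * f x)"
  unfolding strictly_convex_def
proof (intro allI impI)
  fix x y :: 'a and u :: real assume *: "x \<noteq> y" "0 < u" "u < 1"
  have "f ((1 - u) *\<^sub>R x + u *\<^sub>R y) < (1 - u) * f x + u * f y"
    using assms(1) * unfolding strictly_convex_def by blast
  from mult_strict_left_mono[OF this \<open>0 < c\<close>]
  show "c * f ((1 - u) *\<^sub>R x + u *\<^sub>R y) < (1 - u) * (c * f x) + u * (c * f y)"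
    by (simp add: algebra_simps)
qed

lemma coercive_scaleR:
  assumes "coercive f" "0 < c"
  shows "coercive (\<lambda>x. c * f x)"
  using filterlim_tendsto_pos_mult_at_top[OF tendsto_const \<open>0 < c\<close> assms(1)[unfolded coercive_def]]
  by (simp add: coercive_def)

lemma strictly_convex_imp_convex_on:
  fixes f :: "'a::real_vector \<Rightarrow> real"
  assumes "strictly_convex f"
  shows "convex_on UNIV f"
proof (rule convex_onI)
  fix u :: real and x y :: 'a assume "0 < u" "u < 1"
  then show "f ((1 - u) *\<^sub>R x + u *\<^sub>R y) \<le> (1 - u) * f x + u * f y"
  proof (cases "x = y")
    case True
    then show ?thesis
      by (simp add: algebra_simps)
  next
    case False
    then show ?thesis
      using assms \<open>0 < u\<close> \<open>u < 1\<close> unfolding strictly_convex_def by (simp add: less_imp_le)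
  qed
qed simp

text \<open>
  The one-dimensional tangent inequality on the line through \<open>u\<close> and \<open>v\<close>.
\<close>

lemma convex_on_above_tangent:
  fixes f :: "'a::euclidean_space \<Rightarrow> real"
  assumes "convex_on UNIV f" "GDERIV f u :> D"
  shows "f u + (v - u) \<bullet> D \<le> f v"
proof -
  define \<phi> where "\<phi> s = f (u + s *\<^sub>R (v - u))" for s :: real
  have "convex_on UNIV \<phi>"
  proof (rule convex_onI)
    fix s r r' :: real assume "0 < s" "s < 1"
    have "u + ((1 - s) *\<^sub>R r + s *\<^sub>R r') *\<^sub>R (v - u) =
        (1 - s) *\<^sub>R (u + r *\<^sub>R (v - u)) + s *\<^sub>R (u + r' *\<^sub>R (v - u))"
      by (simp add: algebra_simps)
    then show "\<phi> ((1 - s) *\<^sub>R r + s *\<^sub>R r') \<le> (1 - s) * \<phi> r + s * \<phi> r'"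
      unfolding \<phi>_def using convex_onD[OF assms(1), of s] \<open>0 < s\<close> \<open>s < 1\<close> by simp
  qed simp
  moreover have "(\<phi> has_real_derivative ((v - u) \<bullet> D)) (at 0)"
  proof -
    have 1: "((\<lambda>s::real. u + s *\<^sub>R (v - u)) has_derivative (\<lambda>s. s *\<^sub>R (v - u))) (at 0)"
      by (auto intro!: derivative_eq_intros)
    have "(f has_derivative (\<lambda>h. h \<bullet> D)) (at (u + 0 *\<^sub>R (v - u)))"
      using assms(2) by (simp add: gderiv_def)
    from has_derivative_compose[OF 1 this]
    show ?thesis
      unfolding has_field_derivative_def \<phi>_def by (rule has_derivative_eq_rhs) (simp add: fun_eq_iff)
  qed
  ultimately have "\<phi> 1 - \<phi> 0 \<ge> ((v - u) \<bullet> D) * (1 - 0)"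
    by (intro convex_on_imp_above_tangent[of UNIV]) auto
  then show ?thesis
    by (simp add: \<phi>_def)
qed

text \<open>
  If the tangent inequality were an equality at \<open>v\<close>, strict convexity would push the value at the
  midpoint below the tangent.
\<close>

lemma strictly_convex_above_tangent:
  fixes f :: "'a::euclidean_space \<Rightarrow> real"
  assumes "strictly_convex f" "GDERIV f u :> D" "v \<noteq> u"
  shows "f u + (v - u) \<bullet> D < f v"
proof -
  define m where "m = (1 - 1/2) *\<^sub>R u + (1/2::real) *\<^sub>R v"
  have "f m < (1 - 1/2) * f u + (1/2) * f v"
    using assms(1)[unfolded strictly_convex_def, rule_format, of u v "1/2"] assms(3)
    by (simp add: m_def)
  moreover have "f u + (m - u) \<bullet> D \<le> f m"
    using assms by (intro convex_on_above_tangent strictly_convex_imp_convex_on)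
  moreover have "(m - u) \<bullet> D = (1/2) * ((v - u) \<bullet> D)"
    by (simp add: m_def inner_diff_left inner_add_left field_simps)
  ultimately show ?thesis
    by simp
qed

text \<open>
  Coercivity makes \<open>w \<mapsto> f w - w \<bullet> q\<close> attain its minimum, where the gradient of \<open>f\<close> equals \<open>q\<close>;
  strict convexity makes the gradient strictly monotone, hence injective.
\<close>

lemma bij_gradient:
  fixes f :: "'a::euclidean_space \<Rightarrow> real"
  assumes f: "strictly_convex f" "coercive f"
    and D: "\<And>w. GDERIV f w :> D w"
  shows "bij D"
proof (rule bijI)
  show "inj D"
  proof (rule injI, rule ccontr)
    fix u v assume "D u = D v" "u \<noteq> v"
    with strictly_convex_above_tangent[OF f(1) D, of v u] strictly_convex_above_tangent[OF f(1) D, of u v]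
    show False by (simp add: inner_diff_left)
  qed
  have "\<exists>w. D w = q" for q
  proof -
    define h where "h w = f w - w \<bullet> q" for w
    have contf: "continuous_on UNIV f"
      using D unfolding gderiv_def
      by (metis continuous_at_imp_continuous_on has_derivative_continuous)
    have "\<forall>\<^sub>F w in at_infinity. norm q + 1 \<le> f w / norm w"
      using f(2) unfolding coercive_def filterlim_at_top by blast
    then obtain B where B: "\<And>w. B \<le> norm w \<Longrightarrow> norm q + 1 \<le> f w / norm w"
      unfolding eventually_at_infinity by blast
    \<comment> \<open>Outside this radius superlinear growth beats both the linear term and the value at \<open>0\<close>.\<close>
    define R where "R = max 1 (max B (f 0))"
    have big: "h w \<ge> h 0" if "R \<le> norm w" for w
    proof -
      have "norm w > 0" "f 0 \<le> norm w"
        using that by (auto simp: R_def)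
      then have "(norm q + 1) * norm w \<le> f w"
        using B[of w] that by (simp add: R_def pos_le_divide_eq)
      moreover have "w \<bullet> q \<le> norm w * norm q"
        by (rule norm_cauchy_schwarz)
      ultimately show ?thesis
        using \<open>f 0 \<le> norm w\<close> by (simp add: h_def algebra_simps)
    qed
    have "\<exists>w\<in>cball 0 R. \<forall>v\<in>cball 0 R. h w \<le> h v"
      unfolding h_def
    proof (rule continuous_attains_inf)
      show "continuous_on (cball 0 R) (\<lambda>w. f w - w \<bullet> q)"
        using continuous_on_subset[OF contf] by (intro continuous_on_diff continuous_on_inner) auto
    qed (auto simp: R_def)
    then obtain w where w: "\<And>v. norm v \<le> R \<Longrightarrow> h w \<le> h v"
      by (metis mem_cball_0)
    have "h w \<le> h 0"
      by (rule w) (simp add: R_def)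
    then have min: "h w \<le> h v" for v
      using w[of v] big[of v] by linarith
    have "(h has_derivative (\<lambda>k. k \<bullet> (D w - q))) (at w)"
      unfolding h_def using D[of w] unfolding gderiv_def
      by (auto intro!: derivative_eq_intros simp: inner_diff_right)
    then have "(\<lambda>k. k \<bullet> (D w - q)) = (\<lambda>k. 0)"
      by (intro differential_zero_maxmin[of w UNIV h]) (auto intro: min)
    then have "D w - q = 0"
      by (metis inner_eq_zero_iff)
    then show ?thesis
      by auto
  qed
  then show "surj D"
    unfolding surj_def by metis
qed

lemma continuous_on_inv_gradient:
  fixes f :: "'a::euclidean_space \<Rightarrow> real"
  assumes "strictly_convex f" "coercive f"
    and "\<And>w. GDERIV f w :> D w" "continuous_on UNIV D"
  shows "continuous_on UNIV (inv D)"
proof -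
  have "bij D"
    using assms(1-3) by (rule bij_gradient)
  then obtain h where h: "homeomorphism UNIV (D ` UNIV) D h"
    using invariance_of_domain_homeomorphism[OF open_UNIV assms(4)] bij_is_inj by auto
  then have "h = inv D"
    unfolding homeomorphism_def using \<open>bij D\<close>
    by (intro ext) (metis UNIV_I bij_inv_eq_iff)
  then show ?thesis
    using h \<open>bij D\<close> by (simp add: homeomorphism_def bij_is_surj)
qed

text \<open>
  Moving from \<open>u\<close> by the gradient \<open>D\<close> itself raises \<open>f\<close> by at least \<open>\<parallel>D\<parallel>\<^sup>2\<close> and at most \<open>K \<parallel>D\<parallel>\<close>.
\<close>

lemma norm_gradient_le_lipschitz:
  fixes f :: "'a::euclidean_space \<Rightarrow> real"
  assumes "convex_on UNIV f" "K-lipschitz_on UNIV f" "GDERIV f u :> D"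
  shows "norm D \<le> K"
proof -
  have "D \<bullet> D \<le> f (u + D) - f u"
    using convex_on_above_tangent[OF assms(1,3), of "u + D"] by simp
  also have "\<dots> \<le> K * norm D"
    using lipschitz_onD[OF assms(2), of "u + D" u] by (simp add: dist_norm)
  finally have "norm D * norm D \<le> K * norm D"
    by (simp add: power2_norm_eq_inner flip: power2_eq_square)
  then show ?thesis
    using lipschitz_on_nonneg[OF assms(2)] by (cases "D = 0") auto
qed

section \<open>Uniqueness of weak derivatives\<close>

lemma sigma_finite_lebesgue: "sigma_finite_measure (lebesgue :: 'a::euclidean_space measure)"
proof
  obtain A :: "'a set set" where A: "countable A" "A \<subseteq> sets lborel" "\<Union> A = space lborel"
      "\<forall>a\<in>A. emeasure lborel a \<noteq> \<infinity>"
    using lborel.sigma_finite_countable by blast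
  show "\<exists>A::'a set set. countable A \<and> A \<subseteq> sets lebesgue \<and> \<Union> A = space lebesgue \<and>
      (\<forall>a\<in>A. emeasure lebesgue a \<noteq> \<infinity>)"
  proof (intro exI conjI ballI)
    fix a assume "a \<in> A"
    then have "a \<in> sets lborel"
      using A(2) by blast
    then show "emeasure lebesgue a \<noteq> \<infinity>"
      using A(4) \<open>a \<in> A\<close> by simp
  qed (use A in auto)
qed

text \<open>
  The primitive determines the density. The sets over which the zero extension of \<open>h\<close> has zero
  integral include all intervals and are closed under complements and disjoint unions, so they
  include all Borel sets, and then all Lebesgue sets.
\<close>

lemma negligible_zero_of_integral_zero:
  fixes h :: "real \<Rightarrow> 'a::euclidean_space"
  assumes h: "h absolutely_integrable_on {a..b}"
    and zero: "\<And>s. s \<in> {a..b} \<Longrightarrow> integral {a..s} h = 0"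
  obtains N where "negligible N" "\<And>r. r \<in> {a..b} - N \<Longrightarrow> h r = 0"
proof -
  define k where "k r = indicat_real {a..b} r *\<^sub>R h r" for r
  have k_if: "k = (\<lambda>r. if r \<in> {a..b} then h r else 0)"
    by (auto simp: k_def indicator_def)
  have k: "integrable lebesgue k"
    using h by (simp add: k_def[abs_def] set_integrable_def)
  have kA: "set_integrable lebesgue A k" if "A \<in> sets lebesgue" for A
    unfolding set_integrable_def by (intro integrable_mult_indicator that k)
  have kabs: "k absolutely_integrable_on UNIV"
    by (rule kA) simp
  have kab: "integral {p..q} k = integral {p..q} h" if "{p..q} \<subseteq> {a..b}" for p q
    by (rule integral_cong) (use that in \<open>auto simp: k_def indicator_def\<close>)
  have Icc: "integral {p..q} k = 0" if "p \<le> q" for p q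
  proof -
    show ?thesis
    proof (cases "{p..q} \<inter> {a..b} = {}")
      case True
      then have "integral {p..q} k = integral {p..q} (\<lambda>_. 0)"
        by (intro integral_cong) (auto simp: k_def)
      then show ?thesis by simp
    next
      case False
      define p' q' where "p' = max p a" and "q' = min q b"
      have le: "a \<le> p'" "p' \<le> q'" "q' \<le> b"
        using False by (auto simp: p'_def q'_def)
      have hi: "h integrable_on {a..b}"
        using h set_lebesgue_integral_eq_integral(1) by blast
      have "integral {p..q} k = integral ({p..q} \<inter> {a..b}) h"
        unfolding k_if using integral_restrict_Int[of "{p..q}" "{a..b}" h] by (simp only: Int_commute)
      also have "{p..q} \<inter> {a..b} = {p'..q'}"
        by (auto simp: p'_def q'_def)
      also have "integral {p'..q'} h = integral {a..q'} h - integral {a..p'} h"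
        using Henstock_Kurzweil_Integration.integral_combine[of a p' q' h] le
          integrable_on_subinterval[OF hi, of a q'] by (simp add: algebra_simps)
      finally show ?thesis
        using zero[of p'] zero[of q'] le by simp
    qed
  qed
  have borel: "set_lebesgue_integral lebesgue A k = 0" if "A \<in> sets borel" for A
    using that
  proof (induction rule: borel_set_induct)
    case empty
    show ?case by (simp add: set_lebesgue_integral_def)
  next
    case (interval p q)
    then show ?case
      using Icc[of p q] set_lebesgue_integral_eq_integral(2)[OF kA, of "{p..q}"] by simp
  next
    case (compl A)
    have univ: "set_lebesgue_integral lebesgue UNIV k = 0"
    proof (cases "a \<le> b")
      case True
      have "set_lebesgue_integral lebesgue UNIV k = set_lebesgue_integral lebesgue {a..b} k"
        unfolding set_lebesgue_integral_def by (rule Bochner_Integration.integral_cong) (auto simp: k_def indicator_def)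
      then show ?thesis
        using Icc[OF True] set_lebesgue_integral_eq_integral(2)[OF kA, of "{a..b}"] by simp
    next
      case False
      then show ?thesis by (simp add: k_def[abs_def] set_lebesgue_integral_def)
    qed
    have "set_lebesgue_integral lebesgue (A \<union> - A) k =
        set_lebesgue_integral lebesgue A k + set_lebesgue_integral lebesgue (- A) k"
      using compl by (intro set_integral_Un kA) auto
    then show ?case
      using univ compl by simp
  next
    case (union f)
    have "set_lebesgue_integral lebesgue (\<Union>i. f i) k = (\<Sum>i. set_lebesgue_integral lebesgue (f i) k)"
    proof (rule lebesgue_integral_countable_add)
      show "f i \<in> sets lebesgue" for i
        using union(2) by simp
      show "f i \<inter> f j = {}" if "i \<noteq> j" for i j
        using union(1) that by (auto simp: disjoint_family_on_def)
      show "set_integrable lebesgue (\<Union>i. f i) k"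
        using union(2) by (intro kA) auto
    qed
    then show ?case
      using union(3) by simp
  qed
  have "AE x in lebesgue. k x = 0"
  proof (rule sigma_finite_measure.density_zero[OF sigma_finite_lebesgue k])
    fix A :: "real set" assume A: "A \<in> sets lebesgue"
    have "AE x in lebesgue. x \<in> main_part lborel A \<longleftrightarrow> x \<in> A"
      using AE_in_main_part[OF A] by (rule AE_completion)
    then have "set_lebesgue_integral lebesgue A k = set_lebesgue_integral lebesgue (main_part lborel A) k"
    proof (intro set_integral_cong_set)
      show "set_borel_measurable lebesgue (main_part lborel A) k" "set_borel_measurable lebesgue A k"
        using kA[OF sets_completionI_sets[OF main_part_sets[OF A]]] kA[OF A]
        by (auto simp: set_integrable_def set_borel_measurable_def)
    qed
    also have "\<dots> = 0"
      using main_part_sets[OF A] by (intro borel) simp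
    finally show "set_lebesgue_integral lebesgue A k = 0" .
  qed
  then obtain N where N: "N \<in> null_sets lebesgue" "{x \<in> space lebesgue. \<not> k x = 0} \<subseteq> N"
    by (auto simp: eventually_ae_filter)
  show ?thesis
  proof
    show "negligible N"
      using N by (simp add: negligible_iff_null_sets)
    show "h r = 0" if "r \<in> {a..b} - N" for r
      using that N(2) by (force simp: k_def)
  qed
qed

lemma has_wderiv_iff:
  "has_wderiv t T y v \<longleftrightarrow> v absolutely_integrable_on {t..T} \<and>
     (\<forall>s\<in>{t..T}. y s = y t + integral {t..s} v)"
proof -
  have "(LINT r:{t..s}|lebesgue. v r) = integral {t..s} v"
    if "v absolutely_integrable_on {t..T}" "s \<in> {t..T}" for s
    by (rule set_lebesgue_integral_eq_integral(2)) (use that in \<open>auto intro: set_integrable_subset\<close>)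
  then show ?thesis
    unfolding has_wderiv_def by auto
qed

lemma has_wderiv_wderiv:
  assumes "has_wderiv t T y v"
  shows "has_wderiv t T y (wderiv t T y)"
  unfolding wderiv_def using assms by (rule someI[of "has_wderiv t T y"])

text \<open>
  Whatever version of the derivative \<open>wderiv\<close> picks, it agrees with any other version off a
  negligible set. This is what makes integrals of nonlinear functions of \<open>wderiv\<close> computable.
\<close>

lemma wderiv_eq:
  assumes "has_wderiv t T y v"
  obtains N where "negligible N" "\<And>r. r \<in> {t..T} - N \<Longrightarrow> wderiv t T y r = v r"
proof -
  define v' where "v' = wderiv t T y"
  have *: "v absolutely_integrable_on {t..T}" "v' absolutely_integrable_on {t..T}"
    "\<And>s. s \<in> {t..T} \<Longrightarrow> integral {t..s} v' = integral {t..s} v"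
    using assms has_wderiv_wderiv[OF assms] unfolding has_wderiv_iff v'_def
    by (blast, blast, metis add_left_cancel)
  have i: "v integrable_on {t..s}" "v' integrable_on {t..s}" if "s \<in> {t..T}" for s
    using that by (auto intro!: integrable_on_subinterval[OF set_lebesgue_integral_eq_integral(1)[OF *(1)]]
      integrable_on_subinterval[OF set_lebesgue_integral_eq_integral(1)[OF *(2)]])
  obtain N where "negligible N" "\<And>r. r \<in> {t..T} - N \<Longrightarrow> v' r - v r = 0"
  proof (rule negligible_zero_of_integral_zero)
    show "(\<lambda>r. v' r - v r) absolutely_integrable_on {t..T}"
      by (intro set_integral_diff(1) *)
    show "integral {t..s} (\<lambda>r. v' r - v r) = 0" if "s \<in> {t..T}" for s
      using *(3)[OF that] i[OF that] by (simp add: Henstock_Kurzweil_Integration.integral_diff)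
  qed blast
  then show ?thesis
    using that by (auto simp: v'_def)
qed

lemma has_wderiv_primitive:
  fixes v :: "real \<Rightarrow> 'a::euclidean_space"
  assumes "continuous_on {t..T} v" "\<And>s. s \<in> {t..T} \<Longrightarrow> y s = x + integral {t..s} v"
  shows "has_wderiv t T y v"
proof (cases "t \<le> T")
  case True
  then have "y t = x"
    using assms(2)[of t] by simp
  then show ?thesis
    using assms by (simp add: has_wderiv_iff absolutely_integrable_continuous_real)
next
  case False
  then show ?thesis
    by (simp add: has_wderiv_iff)
qed

section \<open>Half-spaces, their limits and the conjugate\<close>

definition inner_inf :: "'a::euclidean_space \<Rightarrow> 'a set \<Rightarrow> real" where
  "inner_inf \<zeta> A = (INF z\<in>A. \<zeta> \<bullet> z)"

lemma inner_inf_eqI: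
  assumes "z \<in> A" "\<And>w. w \<in> A \<Longrightarrow> \<zeta> \<bullet> z \<le> \<zeta> \<bullet> w"
  shows "inner_inf \<zeta> A = \<zeta> \<bullet> z"
  unfolding inner_inf_def using assms by (intro cInf_eq_minimum) auto

lemma inner_inf_bounds:
  assumes "z \<in> A" "\<And>w. w \<in> A \<Longrightarrow> c \<le> \<zeta> \<bullet> w"
  shows "c \<le> inner_inf \<zeta> A" "inner_inf \<zeta> A \<le> \<zeta> \<bullet> z"
  unfolding inner_inf_def using assms by (auto intro!: cINF_greatest cINF_lower bdd_belowI2)

text \<open>
  Adding \<open>H\<^sup>+(\<zeta>)\<close> to \<open>A\<close> yields every point strictly above the infimum of \<open>\<zeta>\<close> on \<open>A\<close>; the closure
  adds the boundary, so only the infimum survives.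
\<close>

lemma oplus_Hplus:
  fixes \<zeta> :: "'a::euclidean_space"
  assumes "\<zeta> \<noteq> 0" "A \<noteq> {}" and c: "\<And>w. w \<in> A \<Longrightarrow> c \<le> \<zeta> \<bullet> w"
  shows "oplus A (Hplus \<zeta>) = {z. inner_inf \<zeta> A \<le> \<zeta> \<bullet> z}"
proof
  have lower: "inner_inf \<zeta> A \<le> \<zeta> \<bullet> a" if "a \<in> A" for a
    using inner_inf_bounds(2)[OF that c] .
  show "oplus A (Hplus \<zeta>) \<subseteq> {z. inner_inf \<zeta> A \<le> \<zeta> \<bullet> z}"
    unfolding oplus_def
  proof (rule closure_minimal)
    show "A + Hplus \<zeta> \<subseteq> {z. inner_inf \<zeta> A \<le> \<zeta> \<bullet> z}"
      using lower by (force simp: set_plus_def Hplus_def inner_add_right)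
  qed (rule closed_halfspace_ge[of _ \<zeta>, simplified])
  have "{z. \<zeta> \<bullet> z > inner_inf \<zeta> A} \<subseteq> A + Hplus \<zeta>"
  proof
    fix z assume "z \<in> {z. \<zeta> \<bullet> z > inner_inf \<zeta> A}"
    then obtain a where "a \<in> A" "\<zeta> \<bullet> a < \<zeta> \<bullet> z"
      using \<open>A \<noteq> {}\<close> cINF_less_iff[of A "(\<bullet>) \<zeta>" "\<zeta> \<bullet> z", OF _ bdd_belowI2[of A, OF c]]
      by (auto simp: inner_inf_def)
    then have "z - a \<in> Hplus \<zeta>"
      by (simp add: Hplus_def inner_diff_right)
    with \<open>a \<in> A\<close> have "a + (z - a) \<in> A + Hplus \<zeta>"
      by (rule set_plus_intro)
    then show "z \<in> A + Hplus \<zeta>"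
      by simp
  qed
  then have "closure {z. \<zeta> \<bullet> z > inner_inf \<zeta> A} \<subseteq> oplus A (Hplus \<zeta>)"
    unfolding oplus_def by (rule closure_mono)
  then show "{z. inner_inf \<zeta> A \<le> \<zeta> \<bullet> z} \<subseteq> oplus A (Hplus \<zeta>)"
    using \<open>\<zeta> \<noteq> 0\<close> by simp
qed

lemma zdiff_halfspace:
  fixes \<zeta> :: "'a::euclidean_space"
  assumes "\<zeta> \<noteq> 0"
    and "A \<noteq> {}" "\<And>w. w \<in> A \<Longrightarrow> a \<le> \<zeta> \<bullet> w"
    and "B \<noteq> {}" "\<And>w. w \<in> B \<Longrightarrow> b \<le> \<zeta> \<bullet> w"
  shows "zdiff \<zeta> A B = {z. inner_inf \<zeta> A - inner_inf \<zeta> B \<le> \<zeta> \<bullet> z}"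
proof -
  have "(\<forall>w\<in>B. inner_inf \<zeta> A \<le> \<zeta> \<bullet> (z + w)) \<longleftrightarrow> inner_inf \<zeta> A - inner_inf \<zeta> B \<le> \<zeta> \<bullet> z" for z
  proof -
    have "(\<forall>w\<in>B. inner_inf \<zeta> A \<le> \<zeta> \<bullet> (z + w)) \<longleftrightarrow> (\<forall>w\<in>B. inner_inf \<zeta> A - \<zeta> \<bullet> z \<le> \<zeta> \<bullet> w)"
      by (simp add: inner_add_right algebra_simps)
    also have "\<dots> \<longleftrightarrow> inner_inf \<zeta> A - \<zeta> \<bullet> z \<le> inner_inf \<zeta> B"
      unfolding inner_inf_def[of \<zeta> B]
      by (rule le_cINF_iff[OF assms(4) bdd_belowI2[of B, OF assms(5)], symmetric])
    finally show ?thesis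
      by (auto simp: algebra_simps)
  qed
  then show ?thesis
    using oplus_Hplus[OF assms(1-3)] by (auto simp: zdiff_def image_subset_iff)
qed

lemma inner_inf_halfspace:
  fixes \<zeta> :: "'a::euclidean_space"
  assumes "\<zeta> \<noteq> 0"
  shows "inner_inf \<zeta> {z. c \<le> \<zeta> \<bullet> z} = c"
  using inner_inf_eqI[of "(c / (\<zeta> \<bullet> \<zeta>)) *\<^sub>R \<zeta>" "{z. c \<le> \<zeta> \<bullet> z}" \<zeta>] assms by simp

lemma halfspace_nonempty:
  fixes \<zeta> :: "'a::euclidean_space"
  assumes "\<zeta> \<noteq> 0"
  shows "{z. c \<le> \<zeta> \<bullet> z} \<noteq> {}"
proof -
  have "(c / (\<zeta> \<bullet> \<zeta>)) *\<^sub>R \<zeta> \<in> {z. c \<le> \<zeta> \<bullet> z}"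
    using assms by simp
  then show ?thesis by blast
qed

text \<open>
  A point of the limit half-space is approached by pushing it along \<open>\<zeta>\<close> just far enough to enter
  the approximating half-spaces.
\<close>

lemma set_lim_seq_halfspace:
  fixes \<zeta> :: "'a::euclidean_space"
  assumes "\<zeta> \<noteq> 0" "c \<longlonglongrightarrow> c0"
  shows "set_lim_seq (\<lambda>m. {z. c m \<le> \<zeta> \<bullet> z}) = {z. c0 \<le> \<zeta> \<bullet> z}"
proof (intro equalityI subsetI)
  fix z assume "z \<in> set_lim_seq (\<lambda>m. {z. c m \<le> \<zeta> \<bullet> z})"
  then obtain \<phi> where "\<And>m. c m \<le> \<zeta> \<bullet> \<phi> m" "\<phi> \<longlonglongrightarrow> z"
    unfolding set_lim_seq_def by blast
  then have "c0 \<le> \<zeta> \<bullet> z"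
    using assms(2) by (intro LIMSEQ_le[of c _ "\<lambda>m. \<zeta> \<bullet> \<phi> m"] tendsto_intros) auto
  then show "z \<in> {z. c0 \<le> \<zeta> \<bullet> z}" by simp
next
  fix z assume z: "z \<in> {z. c0 \<le> \<zeta> \<bullet> z}"
  define \<phi> where "\<phi> m = z + (max 0 (c m - \<zeta> \<bullet> z) / (\<zeta> \<bullet> \<zeta>)) *\<^sub>R \<zeta>" for m
  have "c m \<le> \<zeta> \<bullet> \<phi> m" for m
    using assms(1) by (simp add: \<phi>_def inner_add_right)
  moreover have "\<phi> \<longlonglongrightarrow> z + (max 0 (c0 - \<zeta> \<bullet> z) / (\<zeta> \<bullet> \<zeta>)) *\<^sub>R \<zeta>"
    unfolding \<phi>_def using assms by (intro tendsto_intros) auto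
  moreover have "max 0 (c0 - \<zeta> \<bullet> z) = 0"
    using z by simp
  ultimately show "z \<in> set_lim_seq (\<lambda>m. {z. c m \<le> \<zeta> \<bullet> z})"
    unfolding set_lim_seq_def by auto
qed

lemma has_set_lim_halfspace:
  fixes \<zeta> :: "'a::euclidean_space"
  assumes "\<zeta> \<noteq> 0" and A: "\<And>s. s \<in> S - {a} \<Longrightarrow> A s = {z. c s \<le> \<zeta> \<bullet> z}"
    and c: "(c \<longlongrightarrow> c0) (at a within S)"
  shows "has_set_lim A S a {z. c0 \<le> \<zeta> \<bullet> z}"
  unfolding has_set_lim_def
proof (intro allI impI)
  fix \<sigma> :: "nat \<Rightarrow> real" assume \<sigma>: "\<forall>m. \<sigma> m \<in> S - {a}" "\<sigma> \<longlonglongrightarrow> a"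
  then have "(\<lambda>m. c (\<sigma> m)) \<longlonglongrightarrow> c0"
    using c by (auto simp: tendsto_at_iff_sequentially comp_def)
  moreover have "(\<lambda>m. A (\<sigma> m)) = (\<lambda>m. {z. c (\<sigma> m) \<le> \<zeta> \<bullet> z})"
    using A \<sigma>(1) by blast
  ultimately show "set_lim_seq (\<lambda>m. A (\<sigma> m)) = {z. c0 \<le> \<zeta> \<bullet> z}"
    using set_lim_seq_halfspace[OF assms(1)] by simp
qed

text \<open>
  For the limit to be unique, at least one admissible sequence must exist.
\<close>

lemma set_lim_eq:
  assumes "has_set_lim A S a D" "a islimpt S"
  shows "set_lim A S a = D"
proof -
  obtain \<sigma> :: "nat \<Rightarrow> real" where "\<forall>m. \<sigma> m \<in> S - {a}" "\<sigma> \<longlonglongrightarrow> a"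
    using assms(2) unfolding islimpt_sequential by blast
  then have "set_lim_seq (\<lambda>m. A (\<sigma> m)) = E" if "has_set_lim A S a E" for E
    using that unfolding has_set_lim_def by blast
  then have "E = D" if "has_set_lim A S a E" for E
    using that assms(1) by metis
  then show ?thesis
    unfolding set_lim_def using assms(1) by (intro the_equality)
qed

text \<open>
  The conjugate of the set-valued Lagrangian at its base time is the half-space of the scalar
  conjugate of \<open>L\<^sub>\<zeta>\<close>. The point \<open>v\<close> at which the supremum is attained is supplied, because here
  it is the initial velocity of the optimal path.
\<close>

lemma fenchel_conj_Lset:
  fixes \<zeta> :: "'d::euclidean_space" and L :: "'n::euclidean_space \<Rightarrow> 'd"
  assumes "\<zeta> \<in> dual_cone C - {0}" "0 \<in> C" "d t t = 1"
    and max: "\<And>w. \<eta> \<bullet> w - L w \<bullet> \<zeta> \<le> \<eta> \<bullet> v - L v \<bullet> \<zeta>"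
  shows "fenchel_conj (Lset C L d t t) \<eta> \<zeta> = {z. \<eta> \<bullet> v - L v \<bullet> \<zeta> \<le> \<zeta> \<bullet> z}"
proof -
  have "\<zeta> \<noteq> 0" using assms(1) by simp
  have "zdiff \<zeta> (Ssc \<eta> \<zeta> w) (Lset C L d t t w) = {z. \<eta> \<bullet> w - L w \<bullet> \<zeta> \<le> \<zeta> \<bullet> z}" for w
  proof -
    have ge: "\<zeta> \<bullet> L w \<le> \<zeta> \<bullet> z" if "z \<in> Lset C L d t t w" for z
      using that assms(1,3) by (auto simp: Lset_def dual_cone_def inner_add_right)
    have mem: "L w \<in> Lset C L d t t w"
      using assms(2,3) by (force simp: Lset_def)
    show ?thesis
      using zdiff_halfspace[OF \<open>\<zeta> \<noteq> 0\<close> halfspace_nonempty[OF \<open>\<zeta> \<noteq> 0\<close>, of "\<eta> \<bullet> w"],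
          of "\<eta> \<bullet> w" "Lset C L d t t w", OF _ _ ge] mem
        inner_inf_halfspace[OF \<open>\<zeta> \<noteq> 0\<close>, of "\<eta> \<bullet> w"] inner_inf_eqI[OF mem ge]
      by (simp add: Ssc_def inner_commute[of \<zeta> "L w"] ex_in_conv[symmetric])
        (metis (no_types, lifting))
  qed
  then show ?thesis
    unfolding fenchel_conj_def using max by (auto intro: order_trans)
qed

text \<open>
  The bipolar theorem: a functional that separates a point from the cone \<open>C\<close> is bounded below on
  \<open>C\<close>, and homogeneity forces it to be nonnegative there.
\<close>

lemma closed_convex_cone_eq_Inter_Hplus:
  fixes C :: "'a::euclidean_space set"
  assumes "closed C" "convex_cone C"
  shows "(\<Inter>\<zeta>\<in>dual_cone C - {0}. Hplus \<zeta>) = C"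
proof (intro equalityI subsetI)
  fix z assume z: "z \<in> (\<Inter>\<zeta>\<in>dual_cone C - {0}. Hplus \<zeta>)"
  show "z \<in> C"
  proof (rule ccontr)
    assume "z \<notin> C"
    then obtain \<zeta> b where b: "\<zeta> \<bullet> z < b" "\<And>w. w \<in> C \<Longrightarrow> b < \<zeta> \<bullet> w"
      using separating_hyperplane_closed_point[of C z] assms by (auto simp: convex_cone_def)
    have "0 \<in> C"
      using assms(2) by (simp add: convex_cone_iff)
    then have "b < 0"
      using b(2)[of 0] by simp
    have "0 \<le> \<zeta> \<bullet> w" if "w \<in> C" for w
    proof (rule ccontr)
      assume neg: "\<not> 0 \<le> \<zeta> \<bullet> w"
      then have "(b / (\<zeta> \<bullet> w)) *\<^sub>R w \<in> C"
        using assms(2) that \<open>b < 0\<close> by (intro convex_cone_scaleR) (auto simp: divide_nonpos_neg)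
      from b(2)[OF this] show False
        using neg by simp
    qed
    then have "\<zeta> \<in> dual_cone C"
      by (simp add: dual_cone_def)
    moreover have "\<zeta> \<noteq> 0"
      using b(1) \<open>b < 0\<close> by auto
    ultimately have "0 \<le> \<zeta> \<bullet> z"
      using z by (auto simp: Hplus_def)
    then show False
      using b(1) \<open>b < 0\<close> by simp
  qed
qed (auto simp: dual_cone_def Hplus_def)

text \<open>
  What \<open>C\<^sup>+\<close> cannot see lies in the lineality space \<open>C \<inter> -C\<close>.
\<close>

lemma orthogonal_dual_cone_subset:
  fixes C :: "'a::euclidean_space set"
  assumes "closed C" "convex_cone C" and z: "\<And>\<zeta>. \<zeta> \<in> dual_cone C \<Longrightarrow> \<zeta> \<bullet> z = 0"
  shows "z \<in> C" "- z \<in> C"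
  using z closed_convex_cone_eq_Inter_Hplus[OF assms(1,2)] by (auto simp: Hplus_def)

section \<open>Extremals of the scalar problem\<close>

lemma integral_at_left_end:
  fixes f :: "real \<Rightarrow> 'a::banach"
  assumes "continuous_on {t..T} f" "t \<le> T"
  shows "((\<lambda>s. integral {t..t + s} f) has_vector_derivative f t) (at 0 within {0..T - t})"
proof -
  have 1: "((\<lambda>s. t + s) has_vector_derivative 1) (at 0 within {0..T - t})"
    by (auto intro!: derivative_eq_intros)
  have im: "(\<lambda>s. t + s) ` {0..T - t} = {t..T}"
    using assms(2) by (simp add: image_add_atLeastAtMost)
  have "((\<lambda>u. integral {t..u} f) has_vector_derivative f t) (at (t + 0) within (\<lambda>s. t + s) ` {0..T - t})"
    unfolding im using integral_has_vector_derivative[OF assms(1), of t] assms(2) by simp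
  from vector_diff_chain_within[OF 1 this] show ?thesis
    by (simp add: comp_def)
qed

text \<open>
  The scalar problem for a fixed \<open>\<zeta>\<close>: \<open>l\<close> and \<open>\<gamma>\<close> stand for \<open>L\<^sub>\<zeta>\<close> and \<open>g\<^sub>\<zeta>\<close>, and \<open>Dl\<close>, \<open>D\<gamma>\<close> for their
  gradients.
\<close>

locale discounted_problem =
  fixes l \<gamma> :: "'n::euclidean_space \<Rightarrow> real" and Dl D\<gamma> :: "'n \<Rightarrow> 'n"
    and d d' :: "real \<Rightarrow> real \<Rightarrow> real" and T a t K :: real and x :: 'n
  assumes grad_l: "\<And>w. GDERIV l w :> Dl w" and cont_Dl: "continuous_on UNIV Dl"
    and l_convex: "strictly_convex l" and l_coercive: "coercive l"
    and grad_\<gamma>: "\<And>w. GDERIV \<gamma> w :> D\<gamma> w" and diff_D\<gamma>: "\<And>w. D\<gamma> differentiable (at w)"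
    and \<gamma>_convex: "convex_on UNIV \<gamma>" and \<gamma>_lipschitz: "K-lipschitz_on UNIV \<gamma>"
    and a_pos: "0 < a"
    and disc: "\<And>\<tau>. \<tau> \<in> {0..T} \<Longrightarrow>
          continuous_on {\<tau>..T} (d \<tau>) \<and> d \<tau> ` {\<tau>..T} \<subseteq> {a<..1} \<and> d \<tau> \<tau> = 1"
    and disc_deriv: "\<And>\<tau> s. 0 \<le> \<tau> \<Longrightarrow> \<tau> \<le> s \<Longrightarrow> s \<le> T \<Longrightarrow>
          ((\<lambda>\<tau>. d \<tau> s) has_real_derivative d' \<tau> s) (at \<tau> within {0..s})"
    and cont_d': "continuous_on {(t, s). 0 \<le> t \<and> t \<le> s \<and> s \<le> T} (\<lambda>(t, s). d' t s)"
    and t_range: "0 \<le> t" "t < T"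
begin

text \<open>
  The velocity of the extremal with constant costate \<open>p\<close>: it solves the Euler equation
  \<open>d\<^sub>t(r) \<nabla>l(y'(r)) = p\<close>.
\<close>

definition control :: "'n \<Rightarrow> real \<Rightarrow> 'n" where
  "control p r = inv Dl (p /\<^sub>R d t r)"

lemma bij_Dl: "bij Dl"
  using bij_gradient[OF l_convex l_coercive grad_l] .

lemma Dl_inv [simp]: "Dl (inv Dl p) = p"
  by (rule surj_f_inv_f[OF bij_is_surj[OF bij_Dl]])

lemma cont_inv_Dl: "continuous_on S (inv Dl)"
  using continuous_on_inv_gradient[OF l_convex l_coercive grad_l cont_Dl]
  by (rule continuous_on_subset) simp

lemma cont_l: "continuous_on S l"
  using grad_l unfolding gderiv_def
  by (metis continuous_at_imp_continuous_on has_derivative_continuous)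

lemma l_tangent: "l u + (w - u) \<bullet> Dl u \<le> l w"
  by (rule convex_on_above_tangent[OF strictly_convex_imp_convex_on[OF l_convex] grad_l])

lemma \<gamma>_tangent: "\<gamma> u + (w - u) \<bullet> D\<gamma> u \<le> \<gamma> w"
  by (rule convex_on_above_tangent[OF \<gamma>_convex grad_\<gamma>])

lemma d_bounds:
  assumes "t \<le> \<tau>" "\<tau> \<le> r" "r \<le> T"
  shows "a < d \<tau> r" "d \<tau> r \<le> 1" "0 < d \<tau> r"
proof -
  have "d \<tau> ` {\<tau>..T} \<subseteq> {a<..1}"
    using disc[of \<tau>] assms t_range by simp
  then have "d \<tau> r \<in> {a<..1}"
    using assms by (auto simp: image_subset_iff)
  then show "a < d \<tau> r" "d \<tau> r \<le> 1" "0 < d \<tau> r"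
    using a_pos by auto
qed

lemma d_diag: "d t t = 1"
  using disc[of t] t_range by simp

lemma cont_d:
  assumes "t \<le> \<tau>" "S \<subseteq> {\<tau>..T}"
  shows "continuous_on S (d \<tau>)"
proof (cases "\<tau> \<le> T")
  case True
  then show ?thesis
    using disc[of \<tau>] assms t_range by (auto intro: continuous_on_subset)
next
  case False
  then have "S = {}" using assms by auto
  then show ?thesis by simp
qed

lemma cont_control: "S \<subseteq> {t..T} \<Longrightarrow> continuous_on S (control p)"
  unfolding control_def
  by (intro continuous_on_compose2[OF cont_inv_Dl[of UNIV]] continuous_intros cont_d)
    (use d_bounds(3)[of t] in force)+

text \<open>
  The transversality condition is a fixed point equation for the costate. Its right-hand side is
  continuous in \<open>p\<close> and bounded by the Lipschitz constant \<open>K\<close> of \<open>\<gamma>\<close>, so Brouwer's theorem applies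
  on a ball (of radius \<open>K + 1\<close>, which is positive even if \<open>K = 0\<close>).
\<close>

lemma ex_costate:
  obtains q where "q = - d t T *\<^sub>R D\<gamma> (x + integral {t..T} (control q))"
proof -
  define f where "f p = - d t T *\<^sub>R D\<gamma> (x + integral {t..T} (control p))" for p
  have K: "0 \<le> K"
    using \<gamma>_lipschitz by (rule lipschitz_on_nonneg)
  have "continuous_on (cball 0 (K + 1)) f"
  proof -
    have 1: "continuous_on (cball 0 (K + 1)) (\<lambda>p. integral (cbox t T) (control p))"
      unfolding control_def
    proof (rule integral_continuous_on_param)
      have nz: "d t r \<noteq> 0" if "r \<in> {t..T}" for r
        using d_bounds(3)[of t r] that by auto
      have "continuous_on (cball (0::'n) (K + 1) \<times> cbox t T) (\<lambda>z. inv Dl (fst z /\<^sub>R d t (snd z)))"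
        by (intro continuous_on_compose2[OF cont_inv_Dl[of UNIV]] continuous_intros
            continuous_on_compose2[OF cont_d[of t "{t..T}"]]) (use nz in auto)
      then show "continuous_on (cball 0 (K + 1) \<times> cbox t T) (\<lambda>(p, r). inv Dl (p /\<^sub>R d t r))"
        by (simp add: case_prod_unfold)
    qed
    have "continuous_on UNIV D\<gamma>"
      using diff_D\<gamma> by (simp add: continuous_at_imp_continuous_on differentiable_imp_continuous_within)
    then have "continuous_on (cball 0 (K + 1)) (\<lambda>p. D\<gamma> (x + integral {t..T} (control p)))"
      by (rule continuous_on_compose2) (use 1 in \<open>auto intro: continuous_on_add continuous_on_const\<close>)
    then show ?thesis
      unfolding f_def by (intro continuous_on_scaleR continuous_on_const)
  qed
  moreover have "f \<in> cball 0 (K + 1) \<rightarrow> cball 0 (K + 1)"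
  proof
    fix p
    have "norm (f p) \<le> 1 * K"
      unfolding f_def norm_scaleR using d_bounds[of t T] t_range K
      by (intro mult_mono norm_gradient_le_lipschitz[OF \<gamma>_convex \<gamma>_lipschitz grad_\<gamma>]) auto
    then show "f p \<in> cball 0 (K + 1)"
      by simp
  qed
  ultimately obtain q where "f q = q"
    using brouwer_ball[of "K + 1" 0 f] K by auto
  then show ?thesis
    using that[of q] by (simp add: f_def)
qed

text \<open>
  The discount factors \<open>d\<^sub>t\<^sub>+\<^sub>s\<close> and \<open>d\<^sub>t\<close> can be compared only on \<open>[t + s, T]\<close>, where both are
  defined.
\<close>

lemma d_mean_value:
  assumes "0 < s" "r \<in> {t + s..T}"
  obtains \<xi> where "\<xi> \<in> {t..t + s}" "d (t + s) r - d t r = d' \<xi> r * s"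
proof -
  have "((\<lambda>\<tau>. d \<tau> r) has_derivative (\<lambda>h. d' \<xi> r * h)) (at \<xi> within {t..t + s})"
    if "t \<le> \<xi>" "\<xi> \<le> t + s" for \<xi>
    using disc_deriv[of \<xi> r, unfolded has_field_derivative_def] that assms t_range
    by (auto intro: has_derivative_subset[of _ _ _ "{0..r}"])
  then have "\<exists>\<xi>\<in>{t<..<t + s}. d (t + s) r - d t r = d' \<xi> r * (t + s - t)"
    using assms(1) mvt_simple[of t "t + s" "\<lambda>\<tau>. d \<tau> r" "\<lambda>\<xi> h. d' \<xi> r * h"] by simp
  then obtain \<xi> where "\<xi> \<in> {t<..<t + s}" "d (t + s) r - d t r = d' \<xi> r * (t + s - t)"
    by blast
  then show ?thesis
    by (intro that[of \<xi>]) auto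
qed

lemma compact_triangle: "compact {(\<tau>, s). 0 \<le> \<tau> \<and> \<tau> \<le> s \<and> s \<le> T}"
proof -
  have "closed {z::real \<times> real. 0 \<le> fst z \<and> fst z \<le> snd z \<and> snd z \<le> T}"
    by (intro closed_Collect_conj closed_Collect_le continuous_intros)
  moreover have "{z. 0 \<le> fst z \<and> fst z \<le> snd z \<and> snd z \<le> T} \<subseteq> cbox (0, 0) (T, T)"
    by (auto simp: cbox_Pair_eq)
  ultimately have "compact {z. 0 \<le> fst z \<and> fst z \<le> snd z \<and> snd z \<le> T}"
    using bounded_subset[OF bounded_cbox] compact_eq_bounded_closed by blast
  then show ?thesis
    by (simp add: case_prod_unfold)
qed

lemma d'_bounded:
  obtains M where "0 \<le> M" "\<forall>\<tau> r. 0 \<le> \<tau> \<longrightarrow> \<tau> \<le> r \<longrightarrow> r \<le> T \<longrightarrow> \<bar>d' \<tau> r\<bar> \<le> M"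
proof -
  have "bounded ((\<lambda>(\<tau>, s). d' \<tau> s) ` {(\<tau>, s). 0 \<le> \<tau> \<and> \<tau> \<le> s \<and> s \<le> T})"
    by (intro compact_imp_bounded compact_continuous_image cont_d' compact_triangle)
  then obtain M where "0 < M" "\<forall>y\<in>(\<lambda>(\<tau>, s). d' \<tau> s) ` {(\<tau>, s). 0 \<le> \<tau> \<and> \<tau> \<le> s \<and> s \<le> T}. norm y \<le> M"
    unfolding bounded_pos by blast
  then show ?thesis
    using that[of M] by force
qed

lemma d'_uniform:
  assumes "0 < \<epsilon>"
  obtains \<delta> where "0 < \<delta>"
    "\<forall>\<xi> r. t \<le> \<xi> \<longrightarrow> \<xi> < t + \<delta> \<longrightarrow> \<xi> \<le> r \<longrightarrow> r \<le> T \<longrightarrow> \<bar>d' \<xi> r - d' t r\<bar> \<le> \<epsilon>"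
proof -
  have "uniformly_continuous_on {(\<tau>, s). 0 \<le> \<tau> \<and> \<tau> \<le> s \<and> s \<le> T} (\<lambda>(\<tau>, s). d' \<tau> s)"
    by (intro compact_uniformly_continuous cont_d' compact_triangle)
  then obtain \<delta> where "0 < \<delta>" and \<delta>:
      "\<forall>z\<in>{(\<tau>, s). 0 \<le> \<tau> \<and> \<tau> \<le> s \<and> s \<le> T}. \<forall>z'\<in>{(\<tau>, s). 0 \<le> \<tau> \<and> \<tau> \<le> s \<and> s \<le> T}. dist z' z < \<delta> \<longrightarrow>
        dist (case z' of (\<tau>, s) \<Rightarrow> d' \<tau> s) (case z of (\<tau>, s) \<Rightarrow> d' \<tau> s) < \<epsilon>"
    using assms unfolding uniformly_continuous_on_def by meson
  show ?thesis
  proof (rule that[OF \<open>0 < \<delta>\<close>], intro allI impI)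
    fix \<xi> r assume "t \<le> \<xi>" "\<xi> < t + \<delta>" "\<xi> \<le> r" "r \<le> T"
    then show "\<bar>d' \<xi> r - d' t r\<bar> \<le> \<epsilon>"
      using \<delta>[THEN bspec[of _ _ "(t, r)"], THEN bspec[of _ _ "(\<xi>, r)"]] t_range by (simp add: dist_Pair_Pair dist_real_def)
  qed
qed

end

locale optimal_costate = discounted_problem +
  fixes q
  assumes costate: "q = - d t T *\<^sub>R D\<gamma> (x + integral {t..T} (control q))"
begin

abbreviation v :: "real \<Rightarrow> 'a" where
  "v \<equiv> control q"

text \<open>
  The cost of the control \<open>v\<close>, optimal for the initial time \<open>t\<close>, when it is started from \<open>x\<close> at
  the later time \<open>\<tau>\<close>. There the first-order condition \<open>d\<^sub>\<tau>(r) \<nabla>l(v(r)) + d\<^sub>\<tau>(T) \<nabla>\<gamma>(y(T)) = 0\<close> fails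
  by \<open>defect\<close>, and \<open>gap\<close> bounds what can be gained from this failure.
\<close>

definition cost :: "real \<Rightarrow> real" where
  "cost \<tau> = integral {\<tau>..T} (\<lambda>r. d \<tau> r * l (v r)) + d \<tau> T * \<gamma> (x + integral {\<tau>..T} v)"

definition slope :: "real \<Rightarrow> 'a" where
  "slope \<tau> = d \<tau> T *\<^sub>R D\<gamma> (x + integral {\<tau>..T} v)"

definition defect :: "real \<Rightarrow> real \<Rightarrow> 'a" where
  "defect \<tau> r = d \<tau> r *\<^sub>R Dl (v r) + slope \<tau>"

definition gap :: "real \<Rightarrow> real \<Rightarrow> real" where
  "gap \<tau> r = norm (defect \<tau> r) * norm (inv Dl (- slope \<tau> /\<^sub>R d \<tau> r) - v r)"

lemma slope_t: "slope t = - q"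
  unfolding slope_def by (metis costate add.inverse_inverse scaleR_minus_left)

lemma Dl_v: "Dl (v r) = q /\<^sub>R d t r"
  by (simp add: control_def)

lemma defect_t: "r \<in> {t..T} \<Longrightarrow> defect t r = 0"
  using d_bounds(3)[of t r] by (simp add: defect_def slope_t Dl_v)

lemma cont_gap:
  assumes "t \<le> \<tau>"
  shows "continuous_on {\<tau>..T} (gap \<tau>)"
  unfolding gap_def defect_def
  by (intro continuous_intros continuous_on_compose2[OF cont_inv_Dl[of UNIV]]
      continuous_on_compose2[OF cont_Dl] cont_d cont_control assms)
    (use assms d_bounds(3)[of \<tau>] in force)+

text \<open>
  The function \<open>w \<mapsto> d\<^sub>\<tau>(r) l(w) + slope \<bullet> w\<close> has its minimum at the point \<open>u\<close> below, where its
  gradient vanishes. The tangent of \<open>l\<close> at \<open>v r\<close> bounds the value at \<open>u\<close> from below by the value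
  at \<open>v r\<close> plus \<open>(u - v r) \<bullet> defect\<close>.
\<close>

lemma running_cost_lower_bound:
  assumes "t \<le> \<tau>" "\<tau> \<le> r" "r \<le> T"
  shows "d \<tau> r * l (v r) + slope \<tau> \<bullet> v r - slope \<tau> \<bullet> w - gap \<tau> r \<le> d \<tau> r * l w"
proof -
  define u where "u = inv Dl (- slope \<tau> /\<^sub>R d \<tau> r)"
  have pos: "0 < d \<tau> r"
    using d_bounds(3) assms .
  have "d \<tau> r * (l u + (w - u) \<bullet> Dl u) \<le> d \<tau> r * l w"
    using pos l_tangent by simp
  moreover have "d \<tau> r * ((w - u) \<bullet> Dl u) = - ((w - u) \<bullet> slope \<tau>)"
    using pos by (simp add: u_def)
  moreover have "d \<tau> r * (l (v r) + (u - v r) \<bullet> Dl (v r)) \<le> d \<tau> r * l u"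
    using pos l_tangent by simp
  moreover have "d \<tau> r * ((u - v r) \<bullet> Dl (v r)) = (u - v r) \<bullet> defect \<tau> r - (u - v r) \<bullet> slope \<tau>"
    by (simp add: defect_def inner_add_right)
  moreover have "- gap \<tau> r \<le> (u - v r) \<bullet> defect \<tau> r"
    using Cauchy_Schwarz_ineq2[of "u - v r" "defect \<tau> r"] by (simp add: gap_def u_def mult.commute)
  ultimately show ?thesis
    by (simp add: algebra_simps inner_diff_left inner_commute)
qed

text \<open>
  The pointwise bound integrated, with the tangent inequality for \<open>\<gamma>\<close> at the endpoint; the terms
  with \<open>slope\<close> cancel. The function \<open>f\<close> stands above the running cost \<open>d\<^sub>\<tau> l(c)\<close> because a selection
  of the set-valued integrand carries an additional nonnegative part from the cone.
\<close>

lemma cost_lower_bound: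
  assumes \<tau>: "\<tau> \<in> {t..T}"
    and c: "c integrable_on {\<tau>..T}" and f: "f integrable_on {\<tau>..T}"
    and N: "negligible N" "\<And>r. r \<in> {\<tau>..T} - N \<Longrightarrow> d \<tau> r * l (c r) \<le> f r"
  shows "cost \<tau> - integral {\<tau>..T} (gap \<tau>) \<le>
    integral {\<tau>..T} f + d \<tau> T * \<gamma> (x + integral {\<tau>..T} c)"
proof -
  define h where "h r = d \<tau> r * l (v r) + slope \<tau> \<bullet> v r - slope \<tau> \<bullet> c r - gap \<tau> r" for r
  have sub: "{\<tau>..T} \<subseteq> {t..T}"
    using \<tau> by auto
  have iv: "v integrable_on {\<tau>..T}"
    by (intro integrable_continuous_real cont_control sub)
  have il: "(\<lambda>r. d \<tau> r * l (v r)) integrable_on {\<tau>..T}"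
    by (intro integrable_continuous_real continuous_intros cont_d
        continuous_on_compose2[OF cont_l[of UNIV]] cont_control sub) (use \<tau> in auto)
  have ig: "gap \<tau> integrable_on {\<tau>..T}"
    using \<tau> by (intro integrable_continuous_real cont_gap) simp
  have lin: "((\<lambda>r. slope \<tau> \<bullet> k r) has_integral slope \<tau> \<bullet> integral {\<tau>..T} k) {\<tau>..T}"
    if "k integrable_on {\<tau>..T}" for k
    using has_integral_linear[OF integrable_integral[OF that] bounded_linear_inner_right[of "slope \<tau>"]]
    by (simp add: comp_def)
  have h: "(h has_integral (integral {\<tau>..T} (\<lambda>r. d \<tau> r * l (v r)) + slope \<tau> \<bullet> integral {\<tau>..T} v
      - slope \<tau> \<bullet> integral {\<tau>..T} c - integral {\<tau>..T} (gap \<tau>))) {\<tau>..T}"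
    unfolding h_def
    by (intro has_integral_diff has_integral_add lin iv c integrable_integral il ig)
  have le: "h r \<le> f r" if "r \<in> {\<tau>..T} - N" for r
    using running_cost_lower_bound[of \<tau> r "c r"] N(2)[OF that] that \<tau> by (simp add: h_def)
  have "((\<lambda>r. if r \<in> N then f r else h r) has_integral integral {\<tau>..T} h) {\<tau>..T}"
    unfolding integral_unique[OF h] by (rule has_integral_spike[OF N(1) _ h]) simp
  then have "integral {\<tau>..T} h \<le> integral {\<tau>..T} f"
    by (rule has_integral_le) (use le f in auto)
  moreover have "d \<tau> T * (\<gamma> (x + integral {\<tau>..T} v) + (integral {\<tau>..T} c - integral {\<tau>..T} v)
      \<bullet> D\<gamma> (x + integral {\<tau>..T} v)) \<le> d \<tau> T * \<gamma> (x + integral {\<tau>..T} c)"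
    using \<gamma>_tangent[of "x + integral {\<tau>..T} v" "x + integral {\<tau>..T} c"] d_bounds(3)[of \<tau> T] \<tau>
    by simp
  ultimately show ?thesis
    unfolding integral_unique[OF h]
    by (simp add: cost_def slope_def algebra_simps inner_diff_left inner_commute)
qed

end

section \<open>The right derivative of the scalar value\<close>

lemma gderiv_vector_derivative_compose:
  fixes f :: "'a::euclidean_space \<Rightarrow> real"
  assumes "GDERIV f (c s) :> D" "(c has_vector_derivative c') (at s within S)"
  shows "((\<lambda>s. f (c s)) has_real_derivative c' \<bullet> D) (at s within S)"
proof -
  have "((\<lambda>s. f (c s)) has_derivative (\<lambda>h. (h *\<^sub>R c') \<bullet> D)) (at s within S)"
    using has_derivative_compose[OF assms(2)[unfolded has_vector_derivative_def] assms(1)[unfolded gderiv_def]] .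
  then show ?thesis
    unfolding has_field_derivative_def by (rule has_derivative_eq_rhs) (simp add: fun_eq_iff)
qed

context optimal_costate
begin

lemma cont_v: "S \<subseteq> {t..T} \<Longrightarrow> continuous_on S v"
  by (rule cont_control)

definition endpoint :: 'a where
  "endpoint = x + integral {t..T} v"

lemma D\<gamma>_endpoint: "d t T *\<^sub>R D\<gamma> endpoint = - q"
  using slope_t by (simp add: slope_def endpoint_def)

lemma endpoint_derivative:
  "((\<lambda>s. x + integral {t + s..T} v) has_vector_derivative - v t) (at 0 within {0..T - t})"
proof -
  have "((\<lambda>s. endpoint - integral {t..t + s} v) has_vector_derivative - v t) (at 0 within {0..T - t})"
    using integral_at_left_end[OF cont_v[of "{t..T}"]] t_range
    by (auto intro!: derivative_eq_intros)
  then show ?thesis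
  proof (rule has_vector_derivative_transform[rotated 2])
    fix s assume "s \<in> {0..T - t}"
    then show "x + integral {t + s..T} v = endpoint - integral {t..t + s} v"
      using Henstock_Kurzweil_Integration.integral_combine[of t "t + s" T v]
        integrable_continuous_real[OF cont_v[of "{t..T}"]]
      by (simp add: endpoint_def algebra_simps)
  qed (use t_range in simp)
qed

lemma d_T_derivative:
  "((\<lambda>s. d (t + s) T) has_real_derivative d' t T) (at 0 within {0..T - t})"
proof -
  have "((\<lambda>\<tau>. d \<tau> T) has_real_derivative d' t T) (at (t + 0) within (\<lambda>s. t + s) ` {0..T - t})"
    using disc_deriv[of t T] t_range
    by (auto simp: image_add_atLeastAtMost intro: DERIV_subset)
  then have "(((\<lambda>\<tau>. d \<tau> T) \<circ> (\<lambda>s. t + s)) has_real_derivative d' t T * 1) (at 0 within {0..T - t})"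
    by (rule DERIV_image_chain) (auto intro!: derivative_eq_intros)
  then show ?thesis
    by (simp add: comp_def)
qed

text \<open>
  This is where \<open>\<gamma>\<close> must be twice differentiable: the endpoint gradient changes at a bounded
  rate.
\<close>

lemma slope_increment:
  obtains B where "0 \<le> B" "\<forall>\<^sub>F s in at 0 within {0..T - t}. norm (slope (t + s) - slope t) \<le> B * s"
proof -
  obtain G where G: "(D\<gamma> has_derivative G) (at endpoint)"
    using diff_D\<gamma> unfolding differentiable_def by blast
  have "((\<lambda>s. D\<gamma> (x + integral {t + s..T} v)) has_derivative (\<lambda>h. G (h *\<^sub>R - v t))) (at 0 within {0..T - t})"
    using has_derivative_compose[OF endpoint_derivative[unfolded has_vector_derivative_def], of D\<gamma> G] G
    by (simp add: endpoint_def)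
  then have "((\<lambda>s. D\<gamma> (x + integral {t + s..T} v)) has_vector_derivative G (- v t)) (at 0 within {0..T - t})"
    unfolding has_vector_derivative_def
    by (rule has_derivative_eq_rhs) (metis G bounded_linear.linear has_derivative_bounded_linear linear_cmul)
  then have "((\<lambda>s. slope (t + s)) has_vector_derivative
      d (t + 0) T *\<^sub>R G (- v t) + d' t T *\<^sub>R D\<gamma> (x + integral {t + 0..T} v)) (at 0 within {0..T - t})"
    unfolding slope_def by (rule has_vector_derivative_scaleR[OF d_T_derivative])
  then obtain S where S: "((\<lambda>s. slope (t + s)) has_vector_derivative S) (at 0 within {0..T - t})"
    by blast
  then have "\<exists>\<delta>>0. \<forall>s\<in>{0..T - t}. norm (s - 0) < \<delta> \<longrightarrow>
      norm (slope (t + s) - slope (t + 0) - (s - 0) *\<^sub>R S) \<le> 1 * norm (s - 0)"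
    unfolding has_vector_derivative_def has_derivative_within_alt using zero_less_one by blast
  then obtain \<delta> where "0 < \<delta>" and \<delta>: "\<And>s. s \<in> {0..T - t} \<Longrightarrow> \<bar>s\<bar> < \<delta> \<Longrightarrow>
      norm (slope (t + s) - slope t - s *\<^sub>R S) \<le> \<bar>s\<bar>"
    by auto
  have "norm (slope (t + s) - slope t) \<le> (norm S + 1) * s" if "s \<in> {0..T - t}" "\<bar>s\<bar> < \<delta>" for s
    using norm_triangle_sub[of "slope (t + s) - slope t" "s *\<^sub>R S"] \<delta>[OF that] that
    by (simp add: algebra_simps)
  then have "\<forall>\<^sub>F s in at 0 within {0..T - t}. norm (slope (t + s) - slope t) \<le> (norm S + 1) * s"
    unfolding eventually_at using \<open>0 < \<delta>\<close> by (intro exI[of _ \<delta>]) (auto simp: dist_real_def)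
  then show ?thesis
    by (rule that[rotated]) simp
qed

lemma norm_slope_le:
  assumes "\<tau> \<in> {t..T}"
  shows "norm (slope \<tau>) \<le> K"
proof -
  have "norm (slope \<tau>) \<le> 1 * K"
    unfolding slope_def norm_scaleR using d_bounds[of \<tau> T] assms lipschitz_on_nonneg[OF \<gamma>_lipschitz]
    by (intro mult_mono norm_gradient_le_lipschitz[OF \<gamma>_convex \<gamma>_lipschitz grad_\<gamma>]) auto
  then show ?thesis by simp
qed

text \<open>
  At \<open>s = 0\<close> the defect vanishes because \<open>q\<close> is the costate; both of its ingredients, the
  discount ratio \<open>d\<^sub>t\<^sub>+\<^sub>s(r) / d\<^sub>t(r)\<close> and the slope, move by \<open>O(s)\<close>.
\<close>

lemma defect_bound:
  obtains B where "0 \<le> B"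
    "\<forall>\<^sub>F s in at 0 within {0..T - t}. \<forall>r\<in>{t + s..T}. norm (defect (t + s) r) \<le> B * s"
proof -
  obtain M where M: "0 \<le> M" "\<forall>\<tau> r. 0 \<le> \<tau> \<longrightarrow> \<tau> \<le> r \<longrightarrow> r \<le> T \<longrightarrow> \<bar>d' \<tau> r\<bar> \<le> M"
    using d'_bounded .
  obtain B where B: "0 \<le> B" "\<forall>\<^sub>F s in at 0 within {0..T - t}. norm (slope (t + s) - slope t) \<le> B * s"
    using slope_increment .
  have "\<forall>\<^sub>F s in at 0 within {0..T - t}. s \<in> {0..T - t} \<and> s \<noteq> 0"
    unfolding eventually_at_filter by (auto intro!: always_eventually)
  with B(2) have "\<forall>\<^sub>F s in at 0 within {0..T - t}. \<forall>r\<in>{t + s..T}. norm (defect (t + s) r) \<le> (M * norm q / a + B) * s"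
  proof eventually_elim
    case (elim s)
    show ?case
    proof
      fix r assume r: "r \<in> {t + s..T}"
      have "0 < s" using elim by simp
      have "a < d t r"
        using d_bounds(1)[of t r] r elim by simp
      have "defect (t + s) r = (d (t + s) r - d t r) *\<^sub>R (q /\<^sub>R d t r) + (slope (t + s) - slope t)"
        using \<open>a < d t r\<close> a_pos by (simp add: defect_def Dl_v slope_t algebra_simps)
      then have "norm (defect (t + s) r) \<le> \<bar>d (t + s) r - d t r\<bar> * (norm q / d t r) + norm (slope (t + s) - slope t)"
        using norm_triangle_ineq[of "(d (t + s) r - d t r) *\<^sub>R (q /\<^sub>R d t r)" "slope (t + s) - slope t"]
          \<open>a < d t r\<close> a_pos by (simp add: divide_inverse abs_mult mult_ac)
      moreover have "\<bar>d (t + s) r - d t r\<bar> * (norm q / d t r) \<le> (M * s) * (norm q / a)"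
      proof (rule mult_mono)
        obtain \<xi> where \<xi>: "\<xi> \<in> {t..t + s}" "d (t + s) r - d t r = d' \<xi> r * s"
          using d_mean_value[OF \<open>0 < s\<close> r] .
        then show "\<bar>d (t + s) r - d t r\<bar> \<le> M * s"
          using M(2)[rule_format, of \<xi> r] r t_range \<open>0 < s\<close> by (simp add: abs_mult)
        show "norm q / d t r \<le> norm q / a"
          using \<open>a < d t r\<close> a_pos by (intro divide_left_mono) auto
      qed (use M(1) \<open>0 < s\<close> \<open>a < d t r\<close> a_pos in auto)
      ultimately show "norm (defect (t + s) r) \<le> (M * norm q / a + B) * s"
        using elim by (simp add: algebra_simps)
    qed
  qed
  moreover have "0 \<le> M * norm q / a + B"
    using M(1) B(1) a_pos by simp
  ultimately show ?thesis
    using that by blast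
qed

text \<open>
  The defect is \<open>O(s)\<close>. The two velocities in \<open>gap\<close> are values of \<open>(\<nabla>l)\<^sup>-\<^sup>1\<close> at points of the ball of
  radius \<open>K / a\<close> whose distance is at most \<open>\<parallel>defect\<parallel> / a\<close>; uniform continuity of \<open>(\<nabla>l)\<^sup>-\<^sup>1\<close> on that
  ball makes their difference \<open>o(1)\<close>. The product is \<open>o(s)\<close>.
\<close>

lemma gap_integral_small:
  "((\<lambda>s. integral {t + s..T} (gap (t + s)) / s) \<longlongrightarrow> 0) (at 0 within {0..T - t})"
proof (rule tendstoI)
  fix \<epsilon> :: real assume "0 < \<epsilon>"
  obtain B where B: "0 \<le> B"
    "\<forall>\<^sub>F s in at 0 within {0..T - t}. \<forall>r\<in>{t + s..T}. norm (defect (t + s) r) \<le> B * s"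
    using defect_bound .
  define m where "m = B * (T - t) + 1"
  define \<eta> where "\<eta> = \<epsilon> / (2 * m)"
  have den: "0 < m"
    using B(1) t_range by (simp add: m_def add_nonneg_pos)
  then have "0 < \<eta>"
    using \<open>0 < \<epsilon>\<close> by (simp add: \<eta>_def)
  have "uniformly_continuous_on (cball 0 (K / a)) (inv Dl)"
    by (intro compact_uniformly_continuous cont_inv_Dl compact_cball)
  then obtain \<delta> where "0 < \<delta>" and \<delta>: "\<forall>p\<in>cball 0 (K / a). \<forall>p'\<in>cball 0 (K / a).
      dist p' p < \<delta> \<longrightarrow> dist (inv Dl p') (inv Dl p) < \<eta>"
    using \<open>0 < \<eta>\<close> unfolding uniformly_continuous_on_def by meson
  have "\<forall>\<^sub>F s in at 0 within {0..T - t}. s \<in> {0..T - t} \<and> s \<noteq> 0"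
    unfolding eventually_at_filter by (auto intro!: always_eventually)
  moreover have "\<forall>\<^sub>F s in at 0 within {0..T - t}. B * s / a < \<delta>"
  proof -
    have "((\<lambda>s. B * s / a) \<longlongrightarrow> B * 0 / a) (at 0 within {0..T - t})"
      using a_pos by (intro tendsto_intros) auto
    then show ?thesis
      using \<open>0 < \<delta>\<close> by (intro order_tendstoD) auto
  qed
  ultimately show "\<forall>\<^sub>F s in at 0 within {0..T - t}. dist (integral {t + s..T} (gap (t + s)) / s) 0 < \<epsilon>"
    using B(2)
  proof eventually_elim
    case (elim s)
    then have s: "0 < s" "t + s \<le> T" by auto
    have gap: "norm (gap (t + s) r) \<le> B * s * \<eta>" if r: "r \<in> {t + s..T}" for r
    proof -
      have pos: "a < d t r" "a < d (t + s) r"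
        using d_bounds(1)[of t r] d_bounds(1)[of "t + s" r] r s by auto
      define p p' where "p = q /\<^sub>R d t r" and "p' = - slope (t + s) /\<^sub>R d (t + s) r"
      have "norm q \<le> K"
        using norm_slope_le[of t] t_range by (simp add: slope_t)
      then have "p \<in> cball 0 (K / a)"
        using pos a_pos by (simp add: p_def divide_inverse mult.commute[of K] mult_mono le_imp_inverse_le less_imp_le)
      moreover have "p' \<in> cball 0 (K / a)"
        using pos a_pos norm_slope_le[of "t + s"] s
        by (simp add: p'_def divide_inverse mult.commute[of K] mult_mono le_imp_inverse_le less_imp_le)
      moreover have "dist p' p < \<delta>"
      proof -
        have "p' - p = - defect (t + s) r /\<^sub>R d (t + s) r"
          using pos a_pos by (simp add: p_def p'_def defect_def Dl_v algebra_simps)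
        then have "dist p' p = norm (defect (t + s) r) / d (t + s) r"
          using pos a_pos by (simp add: dist_norm divide_inverse mult.commute)
        also have "\<dots> \<le> B * s / a"
          using pos a_pos elim(3) r B(1) s by (intro frac_le) auto
        finally show ?thesis using elim(2) by simp
      qed
      ultimately have "dist (inv Dl p') (inv Dl p) < \<eta>"
        using \<delta> by blast
      then have "norm (inv Dl p' - v r) \<le> \<eta>"
        by (simp add: p_def control_def dist_norm)
      moreover have "norm (defect (t + s) r) \<le> B * s"
        using elim(3) r by blast
      ultimately have "norm (defect (t + s) r) * norm (inv Dl p' - v r) \<le> (B * s) * \<eta>"
        by (intro mult_mono) (use B(1) s in auto)
      then show ?thesis
        by (simp add: gap_def p'_def)
    qed
    have "norm (integral {t + s..T} (gap (t + s))) \<le> B * s * \<eta> * (T - (t + s))"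
      by (rule integral_bound) (use s gap cont_gap in auto)
    also have "\<dots> \<le> B * s * \<eta> * (T - t)"
      using B(1) s \<open>0 < \<eta>\<close> by (intro mult_left_mono) auto
    finally have "norm (integral {t + s..T} (gap (t + s))) / s \<le> B * (T - t) * \<eta>"
      using s by (simp add: field_simps)
    also have "\<dots> \<le> m * \<eta>"
      using \<open>0 < \<eta>\<close> by (intro mult_right_mono) (auto simp: m_def)
    also have "\<dots> = \<epsilon> / 2"
      using den by (simp add: \<eta>_def)
    also have "\<dots> < \<epsilon>"
      using \<open>0 < \<epsilon>\<close> by simp
    finally show ?case
      using s by simp
  qed
qed

definition running_cost :: "real \<Rightarrow> real" where
  "running_cost r = l (v r)"

lemma cont_running_cost: "S \<subseteq> {t..T} \<Longrightarrow> continuous_on S running_cost"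
  unfolding running_cost_def by (rule continuous_on_compose2[OF cont_l[of UNIV] cont_v]) auto

lemma cont_d't: "S \<subseteq> {t..T} \<Longrightarrow> continuous_on S (d' t)"
  using continuous_on_compose2[OF cont_d', of S "\<lambda>r. (t, r)"] t_range
  by (force intro: continuous_intros)

text \<open>
  Differentiation under the integral sign: by the mean value theorem the difference quotient of
  the discount factor is \<open>d'(\<xi>, r)\<close> for some \<open>\<xi>\<close> near \<open>t\<close>, uniformly close to \<open>d'(t, r)\<close>. The lost
  piece \<open>[t, t + s]\<close> of the domain vanishes in the limit.
\<close>

lemma discount_change_derivative:
  "((\<lambda>s. integral {t + s..T} (\<lambda>r. (d (t + s) r - d t r) * running_cost r) / s) \<longlongrightarrow>
     integral {t..T} (\<lambda>r. d' t r * running_cost r)) (at 0 within {0..T - t})"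
proof -
  let ?h = "\<lambda>r. d' t r * running_cost r"
  have cont_h: "continuous_on {t..T} ?h"
    by (intro continuous_on_mult cont_d't cont_running_cost order_refl)
  obtain \<Lambda> where \<Lambda>: "0 < \<Lambda>" "\<forall>r\<in>{t..T}. \<bar>running_cost r\<bar> \<le> \<Lambda>"
  proof -
    have "bounded (running_cost ` {t..T})"
      by (intro compact_imp_bounded compact_continuous_image cont_running_cost order_refl) simp
    then show ?thesis
      using that unfolding bounded_pos by auto
  qed
  have tail: "((\<lambda>s. integral {t + s..T} ?h) \<longlongrightarrow> integral {t..T} ?h) (at 0 within {0..T - t})"
  proof -
    have "((\<lambda>s. integral {t..t + s} ?h) \<longlongrightarrow> integral {t..t + 0} ?h) (at 0 within {0..T - t})"
      using has_vector_derivative_continuous[OF integral_at_left_end[OF cont_h]] t_range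
      by (simp add: continuous_within)
    then have "((\<lambda>s. integral {t..T} ?h - integral {t..t + s} ?h) \<longlongrightarrow> integral {t..T} ?h - 0)
        (at 0 within {0..T - t})"
      by (intro tendsto_diff tendsto_const) simp
    moreover have "\<forall>\<^sub>F s in at 0 within {0..T - t}.
        integral {t..T} ?h - integral {t..t + s} ?h = integral {t + s..T} ?h"
      unfolding eventually_at_filter
    proof (intro always_eventually allI impI)
      fix s assume "s \<in> {0..T - t}"
      then show "integral {t..T} ?h - integral {t..t + s} ?h = integral {t + s..T} ?h"
        using Henstock_Kurzweil_Integration.integral_combine[of t "t + s" T ?h]
          integrable_continuous_real[OF cont_h] by (simp add: algebra_simps)
    qed
    ultimately show ?thesis
      by (simp add: tendsto_cong)
  qed
  have "((\<lambda>s. integral {t + s..T} (\<lambda>r. (d (t + s) r - d t r) * running_cost r) / s - integral {t + s..T} ?h)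
      \<longlongrightarrow> 0) (at 0 within {0..T - t})"
  proof (rule tendstoI)
    fix \<epsilon> :: real assume "0 < \<epsilon>"
    define m where "m = \<Lambda> * (T - t)"
    define \<eta> where "\<eta> = \<epsilon> / (2 * m)"
    have pos: "0 < m"
      using \<Lambda>(1) t_range by (simp add: m_def)
    have "0 < \<eta>"
      using \<open>0 < \<epsilon>\<close> pos by (simp add: \<eta>_def)
    obtain \<delta> where "0 < \<delta>" and \<delta>: "\<forall>\<xi> r. t \<le> \<xi> \<longrightarrow> \<xi> < t + \<delta> \<longrightarrow> \<xi> \<le> r \<longrightarrow> r \<le> T \<longrightarrow> \<bar>d' \<xi> r - d' t r\<bar> \<le> \<eta>"
      using d'_uniform[OF \<open>0 < \<eta>\<close>] .
    have "dist (integral {t + s..T} (\<lambda>r. (d (t + s) r - d t r) * running_cost r) / s - integral {t + s..T} ?h) 0 < \<epsilon>"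
      if s: "0 < s" "s < \<delta>" "t + s \<le> T" for s
    proof -
      let ?k = "\<lambda>r. ((d (t + s) r - d t r) * running_cost r) / s - ?h r"
      have sub: "{t + s..T} \<subseteq> {t..T}"
        using s by auto
      have c1: "continuous_on {t + s..T} (\<lambda>r. (d (t + s) r - d t r) * running_cost r)"
        using s sub by (intro continuous_on_mult continuous_on_diff cont_d cont_running_cost) auto
      have c2: "continuous_on {t + s..T} ?h"
        by (rule continuous_on_subset[OF cont_h sub])
      have c3: "continuous_on {t + s..T} ?k"
        using s by (intro continuous_on_diff continuous_on_divide c1 c2 continuous_on_const) auto
      have "integral {t + s..T} ?k =
          integral {t + s..T} (\<lambda>r. (d (t + s) r - d t r) * running_cost r) / s - integral {t + s..T} ?h"
        using c1 c2 s
        by (subst Henstock_Kurzweil_Integration.integral_diff)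
          (auto intro!: integrable_continuous_real continuous_on_divide continuous_on_const)
      moreover have "norm (integral {t + s..T} ?k) \<le> (\<eta> * \<Lambda>) * (T - (t + s))"
      proof (rule integral_bound)
        fix r assume r: "r \<in> {t + s..T}"
        obtain \<xi> where \<xi>: "\<xi> \<in> {t..t + s}" "d (t + s) r - d t r = d' \<xi> r * s"
          using d_mean_value[OF \<open>0 < s\<close> r] .
        have "?k r = (d' \<xi> r - d' t r) * running_cost r"
          using s unfolding \<xi>(2) by (simp add: algebra_simps)
        moreover have "\<bar>d' \<xi> r - d' t r\<bar> * \<bar>running_cost r\<bar> \<le> \<eta> * \<Lambda>"
          using \<delta>[rule_format, of \<xi> r] \<Lambda>(2) \<xi>(1) r s \<open>0 < \<eta>\<close> by (intro mult_mono) auto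
        ultimately show "norm (?k r) \<le> \<eta> * \<Lambda>"
          by (simp add: abs_mult)
      qed (use s c3 in auto)
      moreover have "(\<eta> * \<Lambda>) * (T - (t + s)) \<le> \<eta> * m"
        using s \<open>0 < \<eta>\<close> \<Lambda>(1) by (simp add: m_def mult.assoc)
      moreover have "\<eta> * m = \<epsilon> / 2"
        using pos by (simp add: \<eta>_def)
      ultimately show ?thesis
        using \<open>0 < \<epsilon>\<close> by (simp add: dist_real_def)
    qed
    then show "\<forall>\<^sub>F s in at 0 within {0..T - t}. dist (integral {t + s..T}
        (\<lambda>r. (d (t + s) r - d t r) * running_cost r) / s - integral {t + s..T} ?h) 0 < \<epsilon>"
      unfolding eventually_at using \<open>0 < \<delta>\<close> by (intro exI[of _ \<delta>]) (auto simp: dist_real_def)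
  qed
  from tendsto_add[OF this tail] show ?thesis
    by simp
qed

text \<open>
  The first bracket is the scalar conjugate \<open>l\<^sup>*(q)\<close>, attained at the initial velocity
  (\<open>conjugate_attained\<close>); the second one will be \<open>\<zeta> \<bullet> w\<close>.
\<close>

definition time_derivative :: real where
  "time_derivative = (q \<bullet> v t - l (v t)) + (integral {t..T} (\<lambda>r. d' t r * l (v r)) + d' t T * \<gamma> endpoint)"

text \<open>
  The cost changes in three ways: the piece \<open>[t, t + s]\<close> of the integral is lost at rate \<open>l(v(t))\<close>
  (as \<open>d\<^sub>t(t) = 1\<close>), the discount factor changes, and the endpoint moves with velocity \<open>-v(t)\<close>. By
  the transversality condition the last effect contributes \<open>q \<bullet> v(t)\<close>.
\<close>

lemma cost_derivative:
  "((\<lambda>s. (cost (t + s) - cost t) / s) \<longlongrightarrow> time_derivative) (at 0 within {0..T - t})"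
proof -
  let ?f = "\<lambda>r. d t r * running_cost r"
  have cont_f: "continuous_on {t..T} ?f"
    by (intro continuous_on_mult cont_d cont_running_cost order_refl)
  have start: "((\<lambda>s. integral {t..t + s} ?f / s) \<longlongrightarrow> running_cost t) (at 0 within {0..T - t})"
    using integral_at_left_end[OF cont_f] t_range
    unfolding has_real_derivative_iff_has_vector_derivative[symmetric] has_field_derivative_iff
    by (simp add: d_diag)
  have "((\<lambda>s. \<gamma> (x + integral {t + s..T} v)) has_real_derivative - v t \<bullet> D\<gamma> endpoint) (at 0 within {0..T - t})"
    using endpoint_derivative grad_\<gamma>[of endpoint]
    by (intro gderiv_vector_derivative_compose) (auto simp: endpoint_def)
  from DERIV_mult[OF d_T_derivative this]
  have "((\<lambda>s. d (t + s) T * \<gamma> (x + integral {t + s..T} v)) has_real_derivative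
      d' t T * \<gamma> endpoint - d t T * (v t \<bullet> D\<gamma> endpoint)) (at 0 within {0..T - t})"
    by (simp add: endpoint_def mult.commute)
  moreover have "d t T * (v t \<bullet> D\<gamma> endpoint) = - (q \<bullet> v t)"
    unfolding inner_scaleR_right[symmetric] D\<gamma>_endpoint by (simp add: inner_commute)
  ultimately have final: "((\<lambda>s. (d (t + s) T * \<gamma> (x + integral {t + s..T} v) - d t T * \<gamma> endpoint) / s) \<longlongrightarrow>
      d' t T * \<gamma> endpoint + q \<bullet> v t) (at 0 within {0..T - t})"
    unfolding has_field_derivative_iff by (simp add: endpoint_def)
  have "((\<lambda>s. - (integral {t..t + s} ?f / s) +
        integral {t + s..T} (\<lambda>r. (d (t + s) r - d t r) * running_cost r) / s +
        (d (t + s) T * \<gamma> (x + integral {t + s..T} v) - d t T * \<gamma> endpoint) / s) \<longlongrightarrow>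
      - running_cost t + integral {t..T} (\<lambda>r. d' t r * running_cost r) + (d' t T * \<gamma> endpoint + q \<bullet> v t))
      (at 0 within {0..T - t})"
    by (intro tendsto_add tendsto_minus start discount_change_derivative final)
  moreover have "- running_cost t + integral {t..T} (\<lambda>r. d' t r * running_cost r) +
      (d' t T * \<gamma> endpoint + q \<bullet> v t) = time_derivative"
    by (simp add: time_derivative_def running_cost_def)
  moreover have "\<forall>\<^sub>F s in at 0 within {0..T - t}. - (integral {t..t + s} ?f / s) +
        integral {t + s..T} (\<lambda>r. (d (t + s) r - d t r) * running_cost r) / s +
        (d (t + s) T * \<gamma> (x + integral {t + s..T} v) - d t T * \<gamma> endpoint) / s = (cost (t + s) - cost t) / s"
    unfolding eventually_at_filter
  proof (intro always_eventually allI impI)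
    fix s assume s: "s \<in> {0..T - t}"
    have sub: "{t + s..T} \<subseteq> {t..T}"
      using s by auto
    have "integral {t + s..T} (\<lambda>r. (d (t + s) r - d t r) * running_cost r) =
        integral {t + s..T} (\<lambda>r. d (t + s) r * running_cost r) - integral {t + s..T} ?f"
      unfolding left_diff_distrib
      by (intro Henstock_Kurzweil_Integration.integral_diff integrable_continuous_real continuous_on_mult
          cont_d cont_running_cost sub) (use s in auto)
    moreover have "integral {t..T} ?f = integral {t..t + s} ?f + integral {t + s..T} ?f"
      using Henstock_Kurzweil_Integration.integral_combine[of t "t + s" T ?f] s
        integrable_continuous_real[OF cont_f] by simp
    ultimately show "- (integral {t..t + s} ?f / s) +
        integral {t + s..T} (\<lambda>r. (d (t + s) r - d t r) * running_cost r) / s +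
        (d (t + s) T * \<gamma> (x + integral {t + s..T} v) - d t T * \<gamma> endpoint) / s = (cost (t + s) - cost t) / s"
      by (simp add: cost_def endpoint_def running_cost_def diff_divide_distrib add_divide_distrib)
  qed
  ultimately show ?thesis
    by (simp add: tendsto_cong)
qed

lemma conjugate_attained: "q \<bullet> w - l w \<le> q \<bullet> v t - l (v t)"
  using l_tangent[of "v t" w] by (simp add: Dl_v d_diag inner_diff_right inner_commute)

text \<open>
  The cost of the extremal with costate \<open>p\<close> exceeds that of \<open>v\<close> by at least the integral of the
  Bregman distance \<open>d\<^sub>t (l(w) - l(v) - (w - v) \<bullet> \<nabla>l(v))\<close>, where \<open>w\<close> is its velocity. If there is no
  excess, this continuous nonnegative function vanishes; already at \<open>r = t\<close> this forces equal
  velocities, hence equal costates.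
\<close>

lemma minimizing_costate_unique:
  assumes "integral {t..T} (\<lambda>r. d t r * l (control p r)) + d t T * \<gamma> (x + integral {t..T} (control p)) \<le>
    cost t"
  shows "p = q"
proof -
  define h where "h r = d t r * (l (control p r) - l (v r) - (control p r - v r) \<bullet> Dl (v r))" for r
  have pos: "0 < d t r" if "r \<in> {t..T}" for r
    using d_bounds(3)[of t r] that by simp
  have nonneg: "0 \<le> h r" if "r \<in> {t..T}" for r
    using pos[OF that] l_tangent[of "v r" "control p r"] by (simp add: h_def)
  have cont_lc: "continuous_on {t..T} (\<lambda>r. d t r * l (control p' r))" for p'
    by (intro continuous_on_mult cont_d continuous_on_compose2[OF cont_l[of UNIV]] cont_control) auto
  have cont_h: "continuous_on {t..T} h"
    unfolding h_def
    by (intro continuous_on_mult continuous_on_diff continuous_on_inner cont_d cont_control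
        continuous_on_compose2[OF cont_l[of UNIV]] continuous_on_compose2[OF cont_Dl]) auto
  have lin: "((\<lambda>r. q \<bullet> control p' r) has_integral q \<bullet> integral {t..T} (control p')) {t..T}" for p'
    using has_integral_linear[OF integrable_integral[OF integrable_continuous_real[OF cont_control]]
        bounded_linear_inner_right[of q], of t T p']
    by (simp add: comp_def)
  have int: "((\<lambda>r. d t r * l (control p r) - d t r * l (v r) - (q \<bullet> control p r - q \<bullet> v r)) has_integral
      integral {t..T} (\<lambda>r. d t r * l (control p r)) - integral {t..T} (\<lambda>r. d t r * l (v r)) -
      (q \<bullet> integral {t..T} (control p) - q \<bullet> integral {t..T} v)) {t..T}"
    by (intro has_integral_diff lin integrable_integral integrable_continuous_real cont_lc)
  have eq: "d t r * l (control p r) - d t r * l (v r) - (q \<bullet> control p r - q \<bullet> v r) = h r"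
    if "r \<in> {t..T}" for r
    using pos[OF that] by (simp add: h_def Dl_v right_diff_distrib inner_diff_right inner_commute flip: mult.assoc)
  have int_h: "(h has_integral
      integral {t..T} (\<lambda>r. d t r * l (control p r)) - integral {t..T} (\<lambda>r. d t r * l (v r)) -
      (q \<bullet> integral {t..T} (control p) - q \<bullet> integral {t..T} v)) {t..T}"
    by (rule has_integral_eq[OF eq int])
  have "d t T * (\<gamma> endpoint + (integral {t..T} (control p) - integral {t..T} v) \<bullet> D\<gamma> endpoint) \<le>
      d t T * \<gamma> (x + integral {t..T} (control p))"
    using pos[of T] \<gamma>_tangent[of endpoint "x + integral {t..T} (control p)"] t_range
    by (simp add: endpoint_def)
  moreover have "d t T * ((integral {t..T} (control p) - integral {t..T} v) \<bullet> D\<gamma> endpoint) =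
      - (q \<bullet> integral {t..T} (control p) - q \<bullet> integral {t..T} v)"
    unfolding inner_scaleR_right[symmetric] D\<gamma>_endpoint
    by (simp add: inner_commute inner_diff_right)
  ultimately have "integral {t..T} h \<le> 0"
    using assms unfolding integral_unique[OF int_h] cost_def by (simp add: endpoint_def algebra_simps)
  moreover have "0 \<le> integral {t..T} h"
    using nonneg int_h by (intro integral_nonneg) (auto simp: integrable_on_def)
  ultimately have "h t = 0"
    using integral_eq_0_iff[OF cont_h t_range(2) nonneg] t_range by auto
  then have "control p t = v t"
    using strictly_convex_above_tangent[OF l_convex grad_l, of "control p t" "v t"]
    by (cases "control p t = v t") (auto simp: h_def d_diag)
  then have "Dl (control p t) = Dl (v t)"
    by simp
  then show "p = q"
    by (simp add: control_def d_diag)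
qed

end

section \<open>Scalarization of the set-valued problem\<close>

lemma inner_set_lebesgue_integral:
  fixes f :: "'a::euclidean_space \<Rightarrow> 'b::euclidean_space"
  assumes "f absolutely_integrable_on S"
  shows "((\<lambda>s. f s \<bullet> \<zeta>) has_integral (LINT s:S|lebesgue. f s) \<bullet> \<zeta>) S"
  using has_integral_linear[OF has_integral_set_lebesgue[OF assms] bounded_linear_inner_left[of \<zeta>]]
  by (simp add: comp_def)

text \<open>
  The standing hypotheses, over arbitrary Euclidean spaces; the minimizing costates, one for each
  \<open>\<zeta>\<close>, enter only with \<open>hamilton_jacobi\<close>.
\<close>

locale vector_problem =
  fixes C Bp :: "'d::euclidean_space set"
    and L g :: "'n::euclidean_space \<Rightarrow> 'd"
    and d d' :: "real \<Rightarrow> real \<Rightarrow> real"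
    and T a t :: real
    and x :: 'n
  assumes C: "closed C" "convex_cone C"
    and Bp: "is_base Bp (dual_cone C)"
    and L_base: "\<And>\<zeta>. \<zeta> \<in> Bp \<Longrightarrow>
          C2_function (\<lambda>w. L w \<bullet> \<zeta>) \<and> strictly_convex (\<lambda>w. L w \<bullet> \<zeta>) \<and> coercive (\<lambda>w. L w \<bullet> \<zeta>)"
    and g_lipschitz: "\<And>\<zeta>. \<zeta> \<in> Bp \<Longrightarrow> \<exists>K. K-lipschitz_on UNIV (\<lambda>w. g w \<bullet> \<zeta>)"
    and g_base: "\<And>\<zeta>. \<zeta> \<in> Bp \<Longrightarrow>
          C2_function (\<lambda>w. g w \<bullet> \<zeta>) \<and> convex_on UNIV (\<lambda>w. g w \<bullet> \<zeta>)"
    and a: "0 < a"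
    and discount: "\<And>t. t \<in> {0..T} \<Longrightarrow>
             continuous_on {t..T} (d t) \<and> d t ` {t..T} \<subseteq> {a<..1} \<and> d t t = 1"
    and discount_deriv: "\<And>t s. 0 \<le> t \<Longrightarrow> t \<le> s \<Longrightarrow> s \<le> T \<Longrightarrow>
             ((\<lambda>\<tau>. d \<tau> s) has_real_derivative d' t s) (at t within {0..s})"
    and discount_deriv_cont: "continuous_on {(t, s). 0 \<le> t \<and> t \<le> s \<and> s \<le> T} (\<lambda>(t, s). d' t s)"
    and t: "t \<in> {0..<T}"
    and I_exists: "\<And>\<zeta> q. C \<inter> uminus ` C \<noteq> {0} \<Longrightarrow> \<zeta> \<in> dual_cone C - {0} \<Longrightarrow>
          set_integrable lebesgue {t..T} (\<lambda>s. d t s *\<^sub>R L (wderiv t T (Y_path L d t x q \<zeta>) s))"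
begin

text \<open>
  The hypotheses are given for the base \<open>B\<^sup>+\<close> only; they are invariant under positive scaling.
\<close>

lemma scalarization:
  assumes "\<zeta> \<in> dual_cone C - {0}"
  shows "\<exists>K. discounted_problem (\<lambda>w. L w \<bullet> \<zeta>) (\<lambda>w. g w \<bullet> \<zeta>)
    (grad (\<lambda>w. L w \<bullet> \<zeta>)) (grad (\<lambda>w. g w \<bullet> \<zeta>)) d d' T a t K"
proof -
  have "\<exists>!(c, \<xi>). 0 < (c::real) \<and> \<xi> \<in> Bp \<and> \<zeta> = c *\<^sub>R \<xi>"
    using Bp assms unfolding is_base_def by blast
  then obtain c \<xi> where c: "0 < (c::real)" "\<xi> \<in> Bp" "\<zeta> = c *\<^sub>R \<xi>"
    by blast
  have L: "C2_function (\<lambda>w. L w \<bullet> \<zeta>)" "strictly_convex (\<lambda>w. L w \<bullet> \<zeta>)" "coercive (\<lambda>w. L w \<bullet> \<zeta>)"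
    using L_base[OF c(2)] C2_function_scaleR[of "\<lambda>w. L w \<bullet> \<xi>" c]
      strictly_convex_scaleR[OF _ c(1), of "\<lambda>w. L w \<bullet> \<xi>"] coercive_scaleR[OF _ c(1), of "\<lambda>w. L w \<bullet> \<xi>"]
    by (simp_all add: c(3))
  have g: "C2_function (\<lambda>w. g w \<bullet> \<zeta>)" "convex_on UNIV (\<lambda>w. g w \<bullet> \<zeta>)"
    using g_base[OF c(2)] C2_function_scaleR[of "\<lambda>w. g w \<bullet> \<xi>" c]
      convex_on_cmul[of c UNIV "\<lambda>w. g w \<bullet> \<xi>"] c(1)
    by (simp_all add: c(3))
  obtain K where "K-lipschitz_on UNIV (\<lambda>w. g w \<bullet> \<xi>)"
    using g_lipschitz[OF c(2)] by blast
  then have lip: "(\<bar>c\<bar> * K)-lipschitz_on UNIV (\<lambda>w. g w \<bullet> \<zeta>)"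
    using lipschitz_on_cmult_real[of K UNIV "\<lambda>w. g w \<bullet> \<xi>" c] by (simp add: c(3))
  have "discounted_problem (\<lambda>w. L w \<bullet> \<zeta>) (\<lambda>w. g w \<bullet> \<zeta>)
    (grad (\<lambda>w. L w \<bullet> \<zeta>)) (grad (\<lambda>w. g w \<bullet> \<zeta>)) d d' T a t (\<bar>c\<bar> * K)"
  proof
    show "continuous_on UNIV (grad (\<lambda>w. L w \<bullet> \<zeta>))"
      using C2_function_grad(2)[OF L(1)]
      by (simp add: continuous_at_imp_continuous_on differentiable_imp_continuous_within)
  qed (use C2_function_grad[OF L(1)] C2_function_grad[OF g(1)] L g lip a discount discount_deriv
      discount_deriv_cont t in simp_all)
  then show ?thesis ..
qed

lemma cont_L_inner:
  assumes "b \<in> span (dual_cone C)"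
  shows "continuous_on UNIV (\<lambda>w. L w \<bullet> b)"
  using assms
proof (induction rule: span_induct_alt)
  case base
  then show ?case by simp
next
  case (step c \<zeta> y)
  have "continuous_on UNIV (\<lambda>w. L w \<bullet> \<zeta>)"
  proof (cases "\<zeta> = 0")
    case False
    then obtain K where "discounted_problem (\<lambda>w. L w \<bullet> \<zeta>) (\<lambda>w. g w \<bullet> \<zeta>)
        (grad (\<lambda>w. L w \<bullet> \<zeta>)) (grad (\<lambda>w. g w \<bullet> \<zeta>)) d d' T a t K"
      using scalarization step(1) by blast
    then show ?thesis
      by (rule discounted_problem.cont_l)
  qed simp
  with step(2) show ?case
    by (simp add: inner_add_right continuous_on_add continuous_on_mult_left)
qed

text \<open>
  The components of \<open>L\<close> in the lineality space of \<open>C\<close> may be arbitrarily irregular, so \<open>L(y')\<close> itself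
  need not be an integrable selection. The orthogonal projection \<open>P\<close> onto the span of \<open>C\<^sup>+\<close> removes
  these components: it changes \<open>L\<close> by an element of \<open>C \<inter> -C\<close> and is invisible to \<open>C\<^sup>+\<close>. Its
  coordinates are linear combinations of the continuous functions \<open>L\<^sub>\<zeta>\<close>.
\<close>

lemma ex_continuous_selection:
  obtains P where "continuous_on UNIV (\<lambda>w. P (L w))"
    "\<forall>z. P z - z \<in> C \<and> z - P z \<in> C" "\<forall>z. \<forall>\<zeta>\<in>dual_cone C. P z \<bullet> \<zeta> = z \<bullet> \<zeta>"
proof -
  obtain B where B: "B \<subseteq> span (dual_cone C)" "pairwise orthogonal B" "\<And>b. b \<in> B \<Longrightarrow> norm b = 1"
    "independent B" "span B = span (dual_cone C)"
    using orthonormal_basis_subspace[OF subspace_span[of "dual_cone C"]] by metis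
  have "finite B"
    using B(4) by (rule independent_imp_finite)
  define P where "P z = (\<Sum>b\<in>B. (z \<bullet> b) *\<^sub>R b)" for z
  have inner: "P z \<bullet> \<zeta> = z \<bullet> \<zeta>" if "\<zeta> \<in> dual_cone C" for z \<zeta>
  proof -
    have "(\<Sum>b\<in>B. (\<zeta> \<bullet> b) *\<^sub>R b) = \<zeta>"
      using that by (intro orthonormal_basis_expand B \<open>finite B\<close>) (auto simp: B(5) intro: span_base)
    then have "z \<bullet> \<zeta> = z \<bullet> (\<Sum>b\<in>B. (\<zeta> \<bullet> b) *\<^sub>R b)"
      by simp
    also have "\<dots> = P z \<bullet> \<zeta>"
      by (simp add: P_def inner_sum_left inner_sum_right inner_commute mult.commute)
    finally show ?thesis ..
  qed
  have "P z - z \<in> C" "- (P z - z) \<in> C" for z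
    using inner by (auto intro!: orthogonal_dual_cone_subset[OF C] simp: inner_diff_right inner_commute)
  moreover have "continuous_on UNIV (\<lambda>w. P (L w))"
    unfolding P_def using B(1) by (intro continuous_on_sum continuous_on_scaleR cont_L_inner continuous_on_const) auto
  ultimately show ?thesis
    using that[of P] inner by simp
qed

text \<open>
  Each point of \<open>J\<^sub>\<tau>(y)\<close> yields data of the form demanded by \<open>cost_lower_bound\<close>: the velocity \<open>c\<close>
  of \<open>y\<close> and the scalarization \<open>f\<close> of a selection. At \<open>\<tau> = T\<close> the integral is \<open>C\<close> by convention, and
  the bound for \<open>c\<close> need only hold off the single point \<open>T\<close>.
\<close>

lemma J_fun_lower:
  assumes \<zeta>: "\<zeta> \<in> dual_cone C" and \<tau>: "\<tau> \<in> {t..T}"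
    and y: "y \<in> admissible T \<tau> x" and z: "z \<in> J_fun C L g d T \<tau> y"
  obtains c f N where "c integrable_on {\<tau>..T}" "f integrable_on {\<tau>..T}" "negligible N"
    "\<forall>r\<in>{\<tau>..T} - N. d \<tau> r * (L (c r) \<bullet> \<zeta>) \<le> f r"
    "integral {\<tau>..T} f + d \<tau> T * (g (x + integral {\<tau>..T} c) \<bullet> \<zeta>) \<le> \<zeta> \<bullet> z"
proof -
  define c where "c = wderiv \<tau> T y"
  have "has_wderiv \<tau> T y c"
    using y has_wderiv_wderiv unfolding admissible_def W11_def c_def by blast
  then have c: "c integrable_on {\<tau>..T}" "y T = x + integral {\<tau>..T} c"
    using y \<tau> set_lebesgue_integral_eq_integral(1) unfolding has_wderiv_iff admissible_def by auto
  obtain m where m: "m \<in> aumann C \<tau> T (\<lambda>s. Lset C L d \<tau> s (c s))" "z = d \<tau> T *\<^sub>R g (y T) + m"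
    using z unfolding J_fun_def c_def by blast
  have z_eq: "\<zeta> \<bullet> z = d \<tau> T * (g (x + integral {\<tau>..T} c) \<bullet> \<zeta>) + \<zeta> \<bullet> m"
    by (simp add: m(2) c(2) inner_add_right inner_commute)
  show ?thesis
  proof (cases "\<tau> = T")
    case True
    then have "0 \<le> \<zeta> \<bullet> m"
      using m(1) \<zeta> by (simp add: aumann_def dual_cone_def)
    then show ?thesis
      using that[of c "\<lambda>_. 0" "{T}", OF _ integrable_0] c(1) z_eq True by simp
  next
    case False
    then obtain F where F: "F absolutely_integrable_on {\<tau>..T}" "m = (LINT s:{\<tau>..T}|lebesgue. F s)"
      "AE s in lebesgue. s \<in> {\<tau>..T} \<longrightarrow> F s \<in> Lset C L d \<tau> s (c s)"
      using m(1) unfolding aumann_def by auto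
    obtain N where N: "N \<in> null_sets lebesgue"
      "{s \<in> space lebesgue. \<not> (s \<in> {\<tau>..T} \<longrightarrow> F s \<in> Lset C L d \<tau> s (c s))} \<subseteq> N"
      using F(3) unfolding eventually_ae_filter by blast
    have "d \<tau> r * (L (c r) \<bullet> \<zeta>) \<le> F r \<bullet> \<zeta>" if "r \<in> {\<tau>..T} - N" for r
    proof -
      have "F r \<in> Lset C L d \<tau> r (c r)"
        using that N(2) by auto
      then obtain k where "k \<in> C" "F r = d \<tau> r *\<^sub>R L (c r) + k"
        unfolding Lset_def by blast
      then show ?thesis
        using \<zeta> by (simp add: dual_cone_def inner_add_left inner_commute[of k])
    qed
    moreover have "((\<lambda>s. F s \<bullet> \<zeta>) has_integral m \<bullet> \<zeta>) {\<tau>..T}"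
      using inner_set_lebesgue_integral[OF F(1)] F(2) by simp
    ultimately show ?thesis
      using that[of c "\<lambda>s. F s \<bullet> \<zeta>" N] c(1) z_eq N(1)
      by (auto simp: negligible_iff_null_sets integral_unique inner_commute integrable_on_def)
  qed
qed

lemma J_fun_attained:
  assumes \<zeta>: "\<zeta> \<in> dual_cone C" and \<tau>: "\<tau> \<in> {t..T}"
    and c: "continuous_on {\<tau>..T} c"
  obtains y z where "y \<in> admissible T \<tau> x" "z \<in> J_fun C L g d T \<tau> y"
    "\<zeta> \<bullet> z = integral {\<tau>..T} (\<lambda>r. d \<tau> r * (L (c r) \<bullet> \<zeta>)) + d \<tau> T * (g (x + integral {\<tau>..T} c) \<bullet> \<zeta>)"
proof -
  define y where "y s = x + integral {\<tau>..s} c" for s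
  have y: "has_wderiv \<tau> T y c"
    using c y_def by (rule has_wderiv_primitive)
  then have adm: "y \<in> admissible T \<tau> x"
    by (auto simp: admissible_def W11_def y_def)
  have zero: "0 \<in> C"
    using C(2) by (simp add: convex_cone_iff)
  show ?thesis
  proof (cases "\<tau> = T")
    case True
    then have "d \<tau> T *\<^sub>R g (y T) \<in> J_fun C L g d T \<tau> y"
      using zero by (force simp: J_fun_def aumann_def)
    moreover have "\<zeta> \<bullet> (d \<tau> T *\<^sub>R g (y T)) = d \<tau> T * (g (y T) \<bullet> \<zeta>)"
      by (simp add: inner_commute)
    ultimately show ?thesis
      using that[OF adm] True by (simp add: y_def)
  next
    case False
    obtain P where P: "continuous_on UNIV (\<lambda>w. P (L w))"
      "\<forall>z. P z - z \<in> C \<and> z - P z \<in> C" "\<forall>z. \<forall>\<zeta>\<in>dual_cone C. P z \<bullet> \<zeta> = z \<bullet> \<zeta>"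
      using ex_continuous_selection .
    obtain N where N: "negligible N" "\<And>r. r \<in> {\<tau>..T} - N \<Longrightarrow> wderiv \<tau> T y r = c r"
      using wderiv_eq[OF y] by blast
    have \<tau>0: "\<tau> \<in> {0..T}"
      using \<tau> t by simp
    define F where "F s = d \<tau> s *\<^sub>R P (L (wderiv \<tau> T y s))" for s
    have "(\<lambda>s. d \<tau> s *\<^sub>R P (L (c s))) absolutely_integrable_on {\<tau>..T}"
      using discount[OF \<tau>0]
      by (intro absolutely_integrable_continuous_real continuous_on_scaleR continuous_on_compose2[OF P(1) c]) auto
    then have F: "F absolutely_integrable_on {\<tau>..T}"
      by (rule absolutely_integrable_spike[OF _ N(1)]) (simp add: F_def N(2))
    have "F s \<in> Lset C L d \<tau> s (wderiv \<tau> T y s)" if "s \<in> {\<tau>..T}" for s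
    proof -
      have "0 < d \<tau> s"
        using discount[OF \<tau>0] that a by force
      then have "d \<tau> s *\<^sub>R (P (L (wderiv \<tau> T y s)) - L (wderiv \<tau> T y s)) \<in> C"
        using P(2) by (intro convex_cone_scaleR C(2)) auto
      then have "d \<tau> s *\<^sub>R L (wderiv \<tau> T y s) + d \<tau> s *\<^sub>R (P (L (wderiv \<tau> T y s)) - L (wderiv \<tau> T y s))
          \<in> Lset C L d \<tau> s (wderiv \<tau> T y s)"
        unfolding Lset_def by (rule imageI)
      then show ?thesis
        by (simp add: F_def scaleR_diff_right)
    qed
    then have "(LINT s:{\<tau>..T}|lebesgue. F s) \<in> aumann C \<tau> T (\<lambda>s. Lset C L d \<tau> s (wderiv \<tau> T y s))"
      using F False unfolding aumann_def by auto
    then have mem: "d \<tau> T *\<^sub>R g (y T) + (LINT s:{\<tau>..T}|lebesgue. F s) \<in> J_fun C L g d T \<tau> y"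
      unfolding J_fun_def by (rule imageI)
    have "((\<lambda>s. d \<tau> s * (L (c s) \<bullet> \<zeta>)) has_integral (LINT s:{\<tau>..T}|lebesgue. F s) \<bullet> \<zeta>) {\<tau>..T}"
      by (rule has_integral_spike[OF N(1) _ inner_set_lebesgue_integral[OF F]])
        (use P(3) \<zeta> in \<open>simp add: F_def N(2)\<close>)
    then show ?thesis
      by (intro that[OF adm mem]) (simp add: integral_unique y_def inner_add_right inner_commute)
  qed
qed

end

text \<open>
  A fixed direction \<open>\<zeta>\<close> together with the costate \<open>q\<close> of its scalar problem.
\<close>

locale scalarized_problem = vector_problem +
  optimal_costate "\<lambda>w. L w \<bullet> \<zeta>" "\<lambda>w. g w \<bullet> \<zeta>" "grad (\<lambda>w. L w \<bullet> \<zeta>)" "grad (\<lambda>w. g w \<bullet> \<zeta>)"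
  for \<zeta> +
  assumes \<zeta>: "\<zeta> \<in> dual_cone C - {0}"
begin

abbreviation U :: "real \<Rightarrow> 'b \<Rightarrow> 'a set" where
  "U \<equiv> U_val C L g d T"

text \<open>
  The control \<open>v\<close> gives the upper bound on the scalar value at every later time, and
  \<open>cost_lower_bound\<close> the lower one. At \<open>\<tau> = t\<close> the two coincide.
\<close>

lemma U_bounds:
  assumes \<tau>: "\<tau> \<in> {t..T}"
  shows "U \<tau> x \<noteq> {}"
    and "\<And>z. z \<in> U \<tau> x \<Longrightarrow> cost \<tau> - integral {\<tau>..T} (gap \<tau>) \<le> \<zeta> \<bullet> z"
    and "cost \<tau> - integral {\<tau>..T} (gap \<tau>) \<le> inner_inf \<zeta> (U \<tau> x)"
    and "inner_inf \<zeta> (U \<tau> x) \<le> cost \<tau>"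
proof -
  have \<zeta>C: "\<zeta> \<in> dual_cone C"
    using \<zeta> by simp
  obtain y z where y: "y \<in> admissible T \<tau> x" "z \<in> J_fun C L g d T \<tau> y" and
    z: "\<zeta> \<bullet> z = integral {\<tau>..T} (\<lambda>r. d \<tau> r * (L (v r) \<bullet> \<zeta>)) + d \<tau> T * (g (x + integral {\<tau>..T} v) \<bullet> \<zeta>)"
    by (rule J_fun_attained[OF \<zeta>C \<tau> cont_v]) (use \<tau> in auto)
  have zU: "z \<in> U \<tau> x"
    unfolding U_val_def set_inf_def using y by (intro subsetD[OF closure_subset]) blast
  then show "U \<tau> x \<noteq> {}" by blast
  have "\<Union> (J_fun C L g d T \<tau> ` admissible T \<tau> x) \<subseteq> {z. cost \<tau> - integral {\<tau>..T} (gap \<tau>) \<le> \<zeta> \<bullet> z}"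
  proof
    fix z assume "z \<in> \<Union> (J_fun C L g d T \<tau> ` admissible T \<tau> x)"
    then obtain y where "y \<in> admissible T \<tau> x" "z \<in> J_fun C L g d T \<tau> y"
      by blast
    then obtain c f N where *: "c integrable_on {\<tau>..T}" "f integrable_on {\<tau>..T}" "negligible N"
      "\<forall>r\<in>{\<tau>..T} - N. d \<tau> r * (L (c r) \<bullet> \<zeta>) \<le> f r"
      "integral {\<tau>..T} f + d \<tau> T * (g (x + integral {\<tau>..T} c) \<bullet> \<zeta>) \<le> \<zeta> \<bullet> z"
      using J_fun_lower[OF \<zeta>C \<tau>] by blast
    show "z \<in> {z. cost \<tau> - integral {\<tau>..T} (gap \<tau>) \<le> \<zeta> \<bullet> z}"
      using cost_lower_bound[OF \<tau> *(1,2,3)] *(4,5) by force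
  qed
  then have "U \<tau> x \<subseteq> {z. cost \<tau> - integral {\<tau>..T} (gap \<tau>) \<le> \<zeta> \<bullet> z}"
    unfolding U_val_def set_inf_def by (rule closure_minimal[OF _ closed_halfspace_ge[of _ \<zeta>, simplified]])
  then show lower: "cost \<tau> - integral {\<tau>..T} (gap \<tau>) \<le> \<zeta> \<bullet> z" if "z \<in> U \<tau> x" for z
    using that by blast
  show "cost \<tau> - integral {\<tau>..T} (gap \<tau>) \<le> inner_inf \<zeta> (U \<tau> x)"
    by (rule inner_inf_bounds(1)[OF zU lower])
  show "inner_inf \<zeta> (U \<tau> x) \<le> cost \<tau>"
    using inner_inf_bounds(2)[OF zU lower] z by (simp add: cost_def)
qed

lemma U_quot_eq:
  assumes "s \<in> {0<..T - t}"
  shows "U_quot U \<zeta> t x s = {z. (inner_inf \<zeta> (U (t + s) x) - inner_inf \<zeta> (U t x)) / s \<le> \<zeta> \<bullet> z}"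
proof -
  let ?c = "inner_inf \<zeta> (U (t + s) x) - inner_inf \<zeta> (U t x)"
  have s: "0 < s" "t + s \<in> {t..T}" and tT: "t \<in> {t..T}"
    using assms t_range by auto
  have "zdiff \<zeta> (U (t + s) x) (U t x) = {z. ?c \<le> \<zeta> \<bullet> z}"
    using \<zeta> by (intro zdiff_halfspace[OF _ U_bounds(1,2)[OF s(2)] U_bounds(1,2)[OF tT]]) auto
  moreover have "(*\<^sub>R) (1 / s) ` {z. ?c \<le> \<zeta> \<bullet> z} = {z. ?c / s \<le> \<zeta> \<bullet> z}"
  proof (intro equalityI subsetI)
    fix z assume "z \<in> {z. ?c / s \<le> \<zeta> \<bullet> z}"
    then have "s *\<^sub>R z \<in> {z. ?c \<le> \<zeta> \<bullet> z}" "z = (1 / s) *\<^sub>R (s *\<^sub>R z)"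
      using s by (auto simp: field_simps)
    then show "z \<in> (*\<^sub>R) (1 / s) ` {z. ?c \<le> \<zeta> \<bullet> z}"
      by blast
  qed (use s in \<open>auto simp: divide_right_mono\<close>)
  ultimately show ?thesis
    unfolding U_quot_def by simp
qed

text \<open>
  The quotient is squeezed between the quotient of \<open>cost\<close> and the same quotient minus the gap
  integral over \<open>s\<close>, which tends to zero.
\<close>

lemma inner_inf_U_derivative:
  "((\<lambda>s. (inner_inf \<zeta> (U (t + s) x) - inner_inf \<zeta> (U t x)) / s) \<longlongrightarrow> time_derivative)
    (at 0 within {0<..T - t})"
proof -
  let ?F = "at 0 within {0<..T - t}"
  let ?G = "\<lambda>s. integral {t + s..T} (gap (t + s)) / s"
  have le: "?F \<le> at 0 within {0..T - t}"
    by (rule at_le) auto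
  have "integral {t..T} (gap t) = integral {t..T} (\<lambda>_. 0)"
    by (rule Henstock_Kurzweil_Integration.integral_cong) (simp add: gap_def defect_t)
  then have ut: "inner_inf \<zeta> (U t x) = cost t"
    using U_bounds(3,4)[of t] t_range by simp
  have "((\<lambda>s. (cost (t + s) - cost t) / s - ?G s) \<longlongrightarrow> time_derivative - 0) ?F"
    by (intro tendsto_diff tendsto_mono[OF le] cost_derivative gap_integral_small)
  then have lower: "((\<lambda>s. (cost (t + s) - cost t) / s - ?G s) \<longlongrightarrow> time_derivative) ?F"
    by simp
  have upper: "((\<lambda>s. (cost (t + s) - cost t) / s) \<longlongrightarrow> time_derivative) ?F"
    by (rule tendsto_mono[OF le cost_derivative])
  have "\<forall>\<^sub>F s in ?F. (cost (t + s) - cost t) / s - ?G s \<le>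
      (inner_inf \<zeta> (U (t + s) x) - inner_inf \<zeta> (U t x)) / s \<and>
      (inner_inf \<zeta> (U (t + s) x) - inner_inf \<zeta> (U t x)) / s \<le> (cost (t + s) - cost t) / s"
    unfolding eventually_at_filter
  proof (intro always_eventually allI impI)
    fix s :: real assume s: "s \<in> {0<..T - t}"
    then have "t + s \<in> {t..T}" by auto
    from U_bounds(3,4)[OF this] s
    show "(cost (t + s) - cost t) / s - ?G s \<le> (inner_inf \<zeta> (U (t + s) x) - inner_inf \<zeta> (U t x)) / s \<and>
      (inner_inf \<zeta> (U (t + s) x) - inner_inf \<zeta> (U t x)) / s \<le> (cost (t + s) - cost t) / s"
      unfolding ut by (auto simp: divide_right_mono simp flip: diff_divide_distrib)
  qed
  then show ?thesis
    unfolding eventually_conj_iff by (elim conjE) (rule tendsto_sandwich[OF _ _ lower upper])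
qed

lemma U_t_halfspace:
  shows "has_U_t U T \<zeta> t x {z. time_derivative \<le> \<zeta> \<bullet> z}"
    and "U_t U T \<zeta> t x = {z. time_derivative \<le> \<zeta> \<bullet> z}"
proof -
  show *: "has_U_t U T \<zeta> t x {z. time_derivative \<le> \<zeta> \<bullet> z}"
    unfolding has_U_t_def
    by (rule has_set_lim_halfspace[OF _ _ inner_inf_U_derivative]) (use \<zeta> U_quot_eq in auto)
  have "0 islimpt {0<..T - t}"
    using t_range by simp
  then show "U_t U T \<zeta> t x = {z. time_derivative \<le> \<zeta> \<bullet> z}"
    unfolding U_t_def using * by (intro set_lim_eq) (simp_all add: has_U_t_def)
qed

abbreviation path :: "'b \<Rightarrow> real \<Rightarrow> 'b" where
  "path p \<equiv> Y_path L d t x p \<zeta>"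

lemma path_eq:
  assumes "s \<in> {t..T}"
  shows "path p s = x + integral {t..s} (control p)"
proof -
  have "control p absolutely_integrable_on {t..s}"
    using assms by (intro absolutely_integrable_continuous_real cont_control) auto
  from set_lebesgue_integral_eq_integral(2)[OF this] show ?thesis
    by (simp add: Y_path_def control_def[abs_def])
qed

lemma path_wderiv: "has_wderiv t T (path p) (control p)"
  by (rule has_wderiv_primitive[OF cont_control path_eq]) auto

text \<open>
  If \<open>C\<close> is pointed, the projection onto the span of \<open>C\<^sup>+\<close> is the identity and \<open>L\<close> is continuous.
  Otherwise integrability is a hypothesis.
\<close>

lemma running_cost_integrable:
  "(\<lambda>s. d t s *\<^sub>R L (wderiv t T (path p) s)) absolutely_integrable_on {t..T}"
proof (cases "C \<inter> uminus ` C = {0}")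
  case True
  obtain P where P: "continuous_on UNIV (\<lambda>w. P (L w))" "\<forall>z. P z - z \<in> C \<and> z - P z \<in> C"
    using ex_continuous_selection by metis
  have "P z = z" for z
  proof -
    have "P z - z \<in> C \<inter> uminus ` C"
      using P(2) by (auto intro!: image_eqI[of _ _ "z - P z"])
    then show ?thesis
      using True by simp
  qed
  then have contL: "continuous_on UNIV L"
    using P(1) by simp
  obtain N where N: "negligible N" "\<And>r. r \<in> {t..T} - N \<Longrightarrow> wderiv t T (path p) r = control p r"
    using wderiv_eq[OF path_wderiv] by blast
  have "(\<lambda>s. d t s *\<^sub>R L (control p s)) absolutely_integrable_on {t..T}"
    by (intro absolutely_integrable_continuous_real continuous_on_scaleR cont_d
        continuous_on_compose2[OF contL] cont_control) auto
  then show ?thesis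
    by (rule absolutely_integrable_spike[OF _ N(1)]) (simp add: N(2))
next
  case False
  then show ?thesis
    by (rule I_exists[OF _ \<zeta>])
qed

text \<open>
  Used with \<open>k = d\<^sub>t\<close> for \<open>I_fun\<close> and \<open>k = d'\<^sub>t\<close> for \<open>w_fun\<close>. The integrability for \<open>d\<^sub>t\<close> carries
  over because \<open>k / d\<^sub>t\<close> is continuous, hence bounded.
\<close>

lemma weighted_cost_inner:
  assumes k: "continuous_on {t..T} k"
  shows "(LINT s:{t..T}|lebesgue. k s *\<^sub>R L (wderiv t T (path p) s)) \<bullet> \<zeta> =
    integral {t..T} (\<lambda>r. k r * (L (control p r) \<bullet> \<zeta>))"
proof -
  have nz: "d t r \<noteq> 0" if "r \<in> {t..T}" for r
    using d_bounds(3)[of t r] that by auto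
  have cont: "continuous_on {t..T} (\<lambda>s. k s / d t s)"
    using nz by (intro continuous_on_divide k cont_d) auto
  have "(\<lambda>s. (k s / d t s) *\<^sub>R (d t s *\<^sub>R L (wderiv t T (path p) s))) absolutely_integrable_on {t..T}"
    by (intro absolutely_integrable_bounded_measurable_product[OF _ _ _ _ running_cost_integrable]
        continuous_imp_measurable_on_sets_lebesgue cont
        compact_imp_bounded compact_continuous_image)
      (auto intro: bounded_bilinear_scaleR simp: bilinear_conv_bounded_bilinear)
  then have int: "(\<lambda>s. k s *\<^sub>R L (wderiv t T (path p) s)) absolutely_integrable_on {t..T}"
    by (rule absolutely_integrable_spike[OF _ negligible_empty]) (simp add: nz)
  obtain N where N: "negligible N" "\<And>r. r \<in> {t..T} - N \<Longrightarrow> wderiv t T (path p) r = control p r"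
    using wderiv_eq[OF path_wderiv] by blast
  have "((\<lambda>r. k r * (L (control p r) \<bullet> \<zeta>)) has_integral
      (LINT s:{t..T}|lebesgue. k s *\<^sub>R L (wderiv t T (path p) s)) \<bullet> \<zeta>) {t..T}"
    by (rule has_integral_spike[OF N(1) _ inner_set_lebesgue_integral[OF int]]) (simp add: N(2))
  then show ?thesis
    by (rule integral_unique[symmetric])
qed

lemma I_fun_path:
  "I_fun L g d T t (path p) \<bullet> \<zeta> =
    integral {t..T} (\<lambda>r. d t r * (L (control p r) \<bullet> \<zeta>)) + d t T * (g (x + integral {t..T} (control p)) \<bullet> \<zeta>)"
  using weighted_cost_inner[OF cont_d[of t "{t..T}"], of p] path_eq[of T p] t_range
  by (simp add: I_fun_def inner_add_left)

lemma arg_min_eq_costate: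
  assumes "is_arg_min (\<lambda>p. I_fun L g d T t (path p) \<bullet> \<zeta>) (\<lambda>_. True) p"
  shows "p = q"
proof (rule minimizing_costate_unique)
  have "I_fun L g d T t (path p) \<bullet> \<zeta> \<le> I_fun L g d T t (path q) \<bullet> \<zeta>"
    using assms by (auto simp: is_arg_min_def not_less)
  then show "integral {t..T} (\<lambda>r. d t r * (L (control p r) \<bullet> \<zeta>)) +
      d t T * (g (x + integral {t..T} (control p)) \<bullet> \<zeta>) \<le> cost t"
    unfolding I_fun_path by (simp add: cost_def)
qed

lemma grad_u_path: "- grad_u g d T t \<zeta> (path q) = q"
  using D\<gamma>_endpoint path_eq[of T q] t_range by (simp add: grad_u_def endpoint_def)

lemma w_fun_path:
  "w_fun L g d' T t (path q) \<bullet> \<zeta> =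
    integral {t..T} (\<lambda>r. d' t r * (L (v r) \<bullet> \<zeta>)) + d' t T * (g endpoint \<bullet> \<zeta>)"
  using weighted_cost_inner[OF cont_d't, of q] path_eq[of T q] t_range
  by (simp add: w_fun_def inner_add_left endpoint_def)

lemma conjugate_path:
  "fenchel_conj (Lset C L d t t) (- grad_u g d T t \<zeta> (path q)) \<zeta> =
    {z. q \<bullet> v t - L (v t) \<bullet> \<zeta> \<le> \<zeta> \<bullet> z}"
  unfolding grad_u_path using C(2) conjugate_attained d_diag
  by (intro fenchel_conj_Lset[OF \<zeta>]) (auto simp: convex_cone_iff)

text \<open>
  The scalar identity \<open>time_derivative = l\<^sup>*(q) + \<zeta> \<bullet> w\<close>, read as an equality of half-spaces.
\<close>

lemma hamilton_jacobi_halfspace: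
  "(\<lambda>z. z - w_fun L g d' T t (path q)) `
    zdiff \<zeta> (U_t U T \<zeta> t x) (fenchel_conj (Lset C L d t t) (- grad_u g d T t \<zeta> (path q)) \<zeta>) = Hplus \<zeta>"
proof -
  have "\<zeta> \<noteq> 0"
    using \<zeta> by simp
  let ?w = "w_fun L g d' T t (path q)"
  have "zdiff \<zeta> (U_t U T \<zeta> t x) (fenchel_conj (Lset C L d t t) (- grad_u g d T t \<zeta> (path q)) \<zeta>) =
      {z. time_derivative - (q \<bullet> v t - L (v t) \<bullet> \<zeta>) \<le> \<zeta> \<bullet> z}"
    unfolding U_t_halfspace(2) conjugate_path
    using zdiff_halfspace[OF \<open>\<zeta> \<noteq> 0\<close> halfspace_nonempty[OF \<open>\<zeta> \<noteq> 0\<close>] _ halfspace_nonempty[OF \<open>\<zeta> \<noteq> 0\<close>],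
        of time_derivative time_derivative "q \<bullet> v t - L (v t) \<bullet> \<zeta>" "q \<bullet> v t - L (v t) \<bullet> \<zeta>"]
    by (simp add: inner_inf_halfspace[OF \<open>\<zeta> \<noteq> 0\<close>])
  also have "time_derivative - (q \<bullet> v t - L (v t) \<bullet> \<zeta>) = \<zeta> \<bullet> ?w"
    using w_fun_path by (simp add: time_derivative_def inner_commute[of \<zeta> ?w])
  also have "(\<lambda>z. z - ?w) ` {z. \<zeta> \<bullet> ?w \<le> \<zeta> \<bullet> z} = Hplus \<zeta>"
  proof (intro equalityI subsetI)
    fix z assume "z \<in> Hplus \<zeta>"
    then show "z \<in> (\<lambda>z. z - ?w) ` {z. \<zeta> \<bullet> ?w \<le> \<zeta> \<bullet> z}"
      by (intro image_eqI[of _ _ "z + ?w"]) (auto simp: Hplus_def inner_add_right)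
  qed (auto simp: Hplus_def inner_diff_right)
  finally show ?thesis .
qed

end

context vector_problem
begin

lemma hamilton_jacobi:
  assumes \<zeta>: "\<zeta> \<in> dual_cone C - {0}"
    and p: "is_arg_min (\<lambda>q. I_fun L g d T t (Y_path L d t x q \<zeta>) \<bullet> \<zeta>) (\<lambda>_. True) p"
  shows "\<exists>D. has_U_t (U_val C L g d T) T \<zeta> t x D"
    and "(\<lambda>z. z - w_fun L g d' T t (Y_path L d t x p \<zeta>)) `
      zdiff \<zeta> (U_t (U_val C L g d T) T \<zeta> t x)
        (fenchel_conj (Lset C L d t t) (- grad_u g d T t \<zeta> (Y_path L d t x p \<zeta>)) \<zeta>) = Hplus \<zeta>"
proof -
  obtain K where "discounted_problem (\<lambda>w. L w \<bullet> \<zeta>) (\<lambda>w. g w \<bullet> \<zeta>)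
      (grad (\<lambda>w. L w \<bullet> \<zeta>)) (grad (\<lambda>w. g w \<bullet> \<zeta>)) d d' T a t K"
    using scalarization[OF \<zeta>] by blast
  then interpret discounted_problem "\<lambda>w. L w \<bullet> \<zeta>" "\<lambda>w. g w \<bullet> \<zeta>"
      "grad (\<lambda>w. L w \<bullet> \<zeta>)" "grad (\<lambda>w. g w \<bullet> \<zeta>)" d d' T a t K x .
  obtain q where q: "q = - d t T *\<^sub>R grad (\<lambda>w. g w \<bullet> \<zeta>) (x + integral {t..T} (control q))"
    using ex_costate .
  interpret scalarized_problem C Bp L g d d' T a t x K q \<zeta>
    by unfold_locales (use q \<zeta> in auto)
  have "p = q"
    using p by (rule arg_min_eq_costate)
  then show "\<exists>D. has_U_t (U_val C L g d T) T \<zeta> t x D"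
    and "(\<lambda>z. z - w_fun L g d' T t (Y_path L d t x p \<zeta>)) `
      zdiff \<zeta> (U_t (U_val C L g d T) T \<zeta> t x)
        (fenchel_conj (Lset C L d t t) (- grad_u g d T t \<zeta> (Y_path L d t x p \<zeta>)) \<zeta>) = Hplus \<zeta>"
    using U_t_halfspace(1) hamilton_jacobi_halfspace by auto
qed

end

section \<open>The Hamilton-Jacobi equation\<close>

theorem corollary6p6:
  fixes C Bp :: "(real ^ 'd) set"
    and L g :: "real ^ 'n \<Rightarrow> real ^ 'd"
    and d d' :: "real \<Rightarrow> real \<Rightarrow> real"
    and T a t :: real
    and x :: "real ^ 'n"
    and p :: "real ^ 'd \<Rightarrow> real ^ 'n"
  assumes C: "closed C" "convex_cone C" "interior C \<noteq> {}"
    and Bp: "is_base Bp (dual_cone C)"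
    and T: "0 < T"
    and h1: "\<And>\<zeta>. \<zeta> \<in> Bp \<Longrightarrow>
          C2_function (\<lambda>w. L w \<bullet> \<zeta>) \<and> strictly_convex (\<lambda>w. L w \<bullet> \<zeta>) \<and> coercive (\<lambda>w. L w \<bullet> \<zeta>)"
    and h2: "\<And>\<zeta>. \<zeta> \<in> Bp \<Longrightarrow> \<exists>K. K-lipschitz_on UNIV (\<lambda>w. g w \<bullet> \<zeta>)"
    and h3: "0 < a"
          "\<And>t. t \<in> {0..T} \<Longrightarrow>
             continuous_on {t..T} (d t) \<and> d t ` {t..T} \<subseteq> {a<..1} \<and> d t t = 1"
    and h4: "\<And>t s. 0 \<le> t \<Longrightarrow> t \<le> s \<Longrightarrow> s \<le> T \<Longrightarrow>
             ((\<lambda>\<tau>. d \<tau> s) has_real_derivative d' t s) (at t within {0..s})"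
          "continuous_on {(t, s). 0 \<le> t \<and> t \<le> s \<and> s \<le> T} (\<lambda>(t, s). d' t s)"
    and h5: "\<And>\<zeta>. \<zeta> \<in> Bp \<Longrightarrow>
          C2_function (\<lambda>w. g w \<bullet> \<zeta>) \<and> convex_on UNIV (\<lambda>w. g w \<bullet> \<zeta>)"
    and t: "t \<in> {0..<T}"
    and I_exists: "\<And>\<zeta> q. C \<inter> uminus ` C \<noteq> {0} \<Longrightarrow> \<zeta> \<in> dual_cone C - {0} \<Longrightarrow>
          set_integrable lebesgue {t..T} (\<lambda>s. d t s *\<^sub>R L (wderiv t T (Y_path L d t x q \<zeta>) s))"
    and p: "\<And>\<zeta>. \<zeta> \<in> dual_cone C - {0} \<Longrightarrow>
          is_arg_min (\<lambda>q. I_fun L g d T t (Y_path L d t x q \<zeta>) \<bullet> \<zeta>) (\<lambda>_. True) (p \<zeta>)"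
  shows "(\<forall>\<zeta>\<in>dual_cone C - {0}. \<exists>D. has_U_t (U_val C L g d T) T \<zeta> t x D) \<and>
         (\<Inter>\<zeta>\<in>dual_cone C - {0}.
            (\<lambda>z. z - w_fun L g d' T t (Y_path L d t x (p \<zeta>) \<zeta>)) `
              zdiff \<zeta> (U_t (U_val C L g d T) T \<zeta> t x)
                      (fenchel_conj (Lset C L d t t) (- grad_u g d T t \<zeta> (Y_path L d t x (p \<zeta>) \<zeta>)) \<zeta>)) = C"
proof -
  interpret vector_problem C Bp L g d d' T a t x
    by unfold_locales (use C Bp h1 h2 h3 h4 h5 t I_exists in blast)+
  have "(\<Inter>\<zeta>\<in>dual_cone C - {0}.
      (\<lambda>z. z - w_fun L g d' T t (Y_path L d t x (p \<zeta>) \<zeta>)) `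
        zdiff \<zeta> (U_t (U_val C L g d T) T \<zeta> t x)
          (fenchel_conj (Lset C L d t t) (- grad_u g d T t \<zeta> (Y_path L d t x (p \<zeta>) \<zeta>)) \<zeta>)) =
      (\<Inter>\<zeta>\<in>dual_cone C - {0}. Hplus \<zeta>)"
    using hamilton_jacobi(2)[OF _ p] by simp
  then show ?thesis
    using hamilton_jacobi(1)[OF _ p] closed_convex_cone_eq_Inter_Hplus[OF C(1,2)] by simp
qed

end
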